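(* Let $\Bbbk$ be a field of characteristic $0$ and let $H$ be a non-cosemisimple Hopf algebra over $\Bbbk$ with coradical filtration $\{H_n\}_{n\ge 0}$. Let $\{e_C\}_{C\in\mathcal S}\subseteq H^\ast$ be a family of coradical orthonormal idempotents. If the coradical $H_0$ is a finite-dimensional Hopf subalgebra of $H$, then there exists an element of $H_1{}^1 = e_{\Bbbk 1}\rightharpoonup H_1$ having infinite Hopf order. Thus $\exp(H)=\infty$.
   Context: For a coalgebra $H$ over a field $\Bbbk$, $\mathcal S$ is the set of simple subcoalgebras of $H$, $H_0=\bigoplus_{C\in\mathcal S}C$ is the coradical, and $\{H_n\}$ is the coradical filtration. A family of coradical orthonormal idempotents is a family $\{e_C\}_{C\in\mathcal S}$ of non-zero idempotents of the dual algebra $H^\ast$ with $e_Ce_D=0$ for $C\ne D$, $\sum_{C}e_C=\varepsilon$ (the sum is well defined because $H$ is locally finite), and $e_C|_D=\delta_{C,D}\,\varepsilon|_D$ for all $C,D\in\mathcal S$; such a family always exists. For $f\in H^\ast$ and $h\in H$, $f\rightharpoonup h=\sum h_{(1)}\langle f,h_{(2)}\rangle$. For a subspace $V\subseteq H$, $V^1=e_{\Bbbk 1}\rightharpoonup V$, where $\Bbbk 1$ is the simple subcoalgebra spanned by the unit. For $n\ge 1$ the $n$th Hopf power of $h\in H$ is $h^{[n]}=\sum h_{(1)}h_{(2)}\cdots h_{(n)}$. It is trivial if $h^{[n]}=\varepsilon(h)1$. The Hopf order of $h$ is the least positive integer $n$ such that $h^{[n]}=\varepsilon(h)1$, and is infinite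 if no such $n$ exists. The exponent $\exp(H)$ is the least positive integer $n$ such that $h^{[n]}=\varepsilon(h)1$ for all $h\in H$, and $\exp(H)=\infty$ if no such $n$ exists. *)

theory Defs
  imports Main "HOL-Library.Poly_Mapping" "HOL-Library.Extended_Nat"
begin

section \<open>Tensor powers of a vector space\<close>

text \<open>
  A finitely supported map \<open>'b list \<Rightarrow>\<^sub>0 'a\<close> is a formal linear combination of words
  over the vector space \<open>'b\<close>; the word \<open>[x\<^sub>1, \<dots>, x\<^sub>n]\<close> stands for \<open>x\<^sub>1 \<otimes> \<dots> \<otimes> x\<^sub>n\<close>.
  An element of the \<open>n\<close>th tensor power is a coset of the span of the multilinearity relations.
  These relations are homogeneous in the length of words, so all tensor powers can be treated
  at once.
\<close>

definition free_scale :: "'a::field \<Rightarrow> ('w \<Rightarrow>\<^sub>0 'a) \<Rightarrow> ('w \<Rightarrow>\<^sub>0 'a)" where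
  "free_scale c p = Poly_Mapping.map ((*) c) p"

definition word :: "'b list \<Rightarrow> ('b list \<Rightarrow>\<^sub>0 'a::field)" where
  "word w = Poly_Mapping.single w 1"

locale tensor_powers = vector_space scale
  for scale :: "'a::field \<Rightarrow> 'b::ab_group_add \<Rightarrow> 'b"
begin

definition multilinearity_relations :: "('b list \<Rightarrow>\<^sub>0 'a) set" where
  "multilinearity_relations =
     {word (u @ [x + y] @ v) - word (u @ [x] @ v) - word (u @ [y] @ v) | u v x y. True} \<union>
     {word (u @ [scale c x] @ v) - free_scale c (word (u @ [x] @ v)) | u v c x. True}"

text \<open>The class of \<open>\<Sum> x\<^sub>1 \<otimes> \<dots> \<otimes> x\<^sub>n\<close>, summed over a list of words. Coefficients other than
  \<open>1\<close> are not needed, as they can be absorbed into a tensor factor.\<close>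

definition tensor :: "'b list list \<Rightarrow> ('b list \<Rightarrow>\<^sub>0 'a) set" where
  "tensor ws = {p. p - (\<Sum>w\<leftarrow>ws. word w) \<in> module.span free_scale multilinearity_relations}"

definition tensor2 :: "('b \<times> 'b) list \<Rightarrow> ('b list \<Rightarrow>\<^sub>0 'a) set" where
  "tensor2 ps = tensor [[a, b]. (a, b) \<leftarrow> ps]"

text \<open>For subspaces \<open>V\<close> and \<open>W\<close>, \<open>tensors (V \<times> W)\<close> is \<open>V \<otimes> W\<close> inside the tensor square, and
  \<open>tensors (V \<times> W \<union> V' \<times> W')\<close> is \<open>V \<otimes> W + V' \<otimes> W'\<close>.\<close>

definition tensors :: "('b \<times> 'b) set \<Rightarrow> ('b list \<Rightarrow>\<^sub>0 'a) set set" where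
  "tensors X = {tensor2 ps | ps. set ps \<subseteq> X}"

text \<open>A choice of a decomposition \<open>t = \<Sum> a \<otimes> b\<close>, for use in Sweedler notation. The expressions
  below are multilinear in the tensor factors, so they do not depend on the choice.\<close>

definition sweedler :: "('b list \<Rightarrow>\<^sub>0 'a) set \<Rightarrow> ('b \<times> 'b) list" where
  "sweedler t = (SOME ps. tensor2 ps = t)"

definition finite_dimensional :: "'b set \<Rightarrow> bool" where
  "finite_dimensional V \<longleftrightarrow> (\<exists>B. finite B \<and> span B = V)"

end


section \<open>Coalgebras\<close>

locale coalgebra = tensor_powers scale
  for scale :: "'a::field \<Rightarrow> 'b::ab_group_add \<Rightarrow> 'b" +
  fixes \<Delta> :: "'b \<Rightarrow> ('b list \<Rightarrow>\<^sub>0 'a) set"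
    and \<epsilon> :: "'b \<Rightarrow> 'a"
  assumes comult_in: "\<Delta> h \<in> tensors UNIV"
    and comult_add: "\<Delta> (h + k) = tensor2 (sweedler (\<Delta> h) @ sweedler (\<Delta> k))"
    and comult_scale: "\<Delta> (scale c h) = tensor2 [(scale c a, b). (a, b) \<leftarrow> sweedler (\<Delta> h)]"
    and counit_linear: "Vector_Spaces.linear scale (*) \<epsilon>"
    and coassoc:
      "tensor [[a1, a2, b]. (a, b) \<leftarrow> sweedler (\<Delta> h), (a1, a2) \<leftarrow> sweedler (\<Delta> a)] =
       tensor [[a, b1, b2]. (a, b) \<leftarrow> sweedler (\<Delta> h), (b1, b2) \<leftarrow> sweedler (\<Delta> b)]"
    and counit_left: "(\<Sum>(a, b)\<leftarrow>sweedler (\<Delta> h). scale (\<epsilon> a) b) = h"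
    and counit_right: "(\<Sum>(a, b)\<leftarrow>sweedler (\<Delta> h). scale (\<epsilon> b) a) = h"
begin

definition subcoalgebra :: "'b set \<Rightarrow> bool" where
  "subcoalgebra D \<longleftrightarrow> subspace D \<and> (\<forall>h\<in>D. \<Delta> h \<in> tensors (D \<times> D))"

definition simple_subcoalgebras :: "'b set set" where
  "simple_subcoalgebras =
     {C. subcoalgebra C \<and> C \<noteq> {0} \<and> (\<forall>D. subcoalgebra D \<and> D \<subseteq> C \<longrightarrow> D = {0} \<or> D = C)}"

definition coradical :: "'b set" where
  "coradical = span (\<Union>simple_subcoalgebras)"

definition cosemisimple :: bool where
  "cosemisimple \<longleftrightarrow> coradical = UNIV"

text \<open>\<open>H\<^bsub>n+1\<^esub> = \<Delta>\<^sup>-\<^sup>1(H \<otimes> H\<^sub>n + H\<^sub>0 \<otimes> H)\<close>\<close>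

primrec coradical_filtration :: "nat \<Rightarrow> 'b set" where
  "coradical_filtration 0 = coradical"
| "coradical_filtration (Suc n) =
     {h. \<Delta> h \<in> tensors (UNIV \<times> coradical_filtration n \<union> coradical \<times> UNIV)}"

definition dual :: "('b \<Rightarrow> 'a) set" where
  "dual = {f. Vector_Spaces.linear scale (*) f}"

definition conv :: "('b \<Rightarrow> 'a) \<Rightarrow> ('b \<Rightarrow> 'a) \<Rightarrow> ('b \<Rightarrow> 'a)" where
  "conv f g = (\<lambda>h. \<Sum>(a, b)\<leftarrow>sweedler (\<Delta> h). f a * g b)"

definition hit :: "('b \<Rightarrow> 'a) \<Rightarrow> 'b \<Rightarrow> 'b"  (infixr \<open>\<rightharpoonup>\<close> 70) where
  "f \<rightharpoonup> h = (\<Sum>(a, b)\<leftarrow>sweedler (\<Delta> h). scale (f b) a)"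

text \<open>The possibly infinite sum of the \<open>e C\<close> is taken pointwise, with only finitely many
  non-zero terms at each element.\<close>

definition coradical_orthonormal_idempotents :: "('b set \<Rightarrow> 'b \<Rightarrow> 'a) \<Rightarrow> bool" where
  "coradical_orthonormal_idempotents e \<longleftrightarrow>
     (\<forall>C\<in>simple_subcoalgebras. e C \<in> dual \<and> e C \<noteq> (\<lambda>_. 0) \<and> conv (e C) (e C) = e C) \<and>
     (\<forall>C\<in>simple_subcoalgebras. \<forall>D\<in>simple_subcoalgebras.
        C \<noteq> D \<longrightarrow> conv (e C) (e D) = (\<lambda>_. 0)) \<and>
     (\<forall>h. finite {C \<in> simple_subcoalgebras. e C h \<noteq> 0} \<and>
        (\<Sum>C\<in>{C \<in> simple_subcoalgebras. e C h \<noteq> 0}. e C h) = \<epsilon> h) \<and>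
     (\<forall>C\<in>simple_subcoalgebras. \<forall>D\<in>simple_subcoalgebras. \<forall>h\<in>D.
        e C h = (if C = D then \<epsilon> h else 0))"

text \<open>The summands of \<open>\<Sum> h\<^sub>1 \<otimes> \<dots> \<otimes> h\<^bsub>n+1\<^esub>\<close>, with \<open>n\<close> applications of \<open>\<Delta>\<close>.\<close>

primrec iterated_comult :: "nat \<Rightarrow> 'b \<Rightarrow> 'b list list" where
  "iterated_comult 0 h = [[h]]"
| "iterated_comult (Suc n) h =
     [w @ [b]. (a, b) \<leftarrow> sweedler (\<Delta> h), w \<leftarrow> iterated_comult n a]"

end


section \<open>Hopf algebras\<close>

locale hopf_algebra = coalgebra scale \<Delta> \<epsilon>
  for scale :: "'a::field \<Rightarrow> 'b::ring_1 \<Rightarrow> 'b"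
    and \<Delta> :: "'b \<Rightarrow> ('b list \<Rightarrow>\<^sub>0 'a) set"
    and \<epsilon> :: "'b \<Rightarrow> 'a" +
  fixes S :: "'b \<Rightarrow> 'b"
  assumes mult_scale_left: "scale c x * y = scale c (x * y)"
    and mult_scale_right: "x * scale c y = scale c (x * y)"
    and comult_one: "\<Delta> 1 = tensor2 [(1, 1)]"
    and comult_mult: "\<Delta> (x * y) =
      tensor2 [(a * c, b * d). (a, b) \<leftarrow> sweedler (\<Delta> x), (c, d) \<leftarrow> sweedler (\<Delta> y)]"
    and counit_one: "\<epsilon> 1 = 1"
    and counit_mult: "\<epsilon> (x * y) = \<epsilon> x * \<epsilon> y"
    and antipode_linear: "Vector_Spaces.linear scale scale S"
    and antipode_left: "(\<Sum>(a, b)\<leftarrow>sweedler (\<Delta> h). S a * b) = scale (\<epsilon> h) 1"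
    and antipode_right: "(\<Sum>(a, b)\<leftarrow>sweedler (\<Delta> h). a * S b) = scale (\<epsilon> h) 1"
begin

definition hopf_subalgebra :: "'b set \<Rightarrow> bool" where
  "hopf_subalgebra K \<longleftrightarrow>
     subcoalgebra K \<and> 1 \<in> K \<and> (\<forall>x\<in>K. \<forall>y\<in>K. x * y \<in> K) \<and> (\<forall>x\<in>K. S x \<in> K)"

text \<open>Intended for \<open>n \<ge> 1\<close> only.\<close>

definition hopf_power :: "'b \<Rightarrow> nat \<Rightarrow> 'b" where
  "hopf_power h n = (\<Sum>w\<leftarrow>iterated_comult (n - 1) h. prod_list w)"

definition trivial_hopf_power :: "'b \<Rightarrow> nat \<Rightarrow> bool" where
  "trivial_hopf_power h n \<longleftrightarrow> hopf_power h n = scale (\<epsilon> h) 1"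

definition hopf_order :: "'b \<Rightarrow> enat" where
  "hopf_order h =
     (if \<exists>n\<ge>1. trivial_hopf_power h n then enat (LEAST n. n \<ge> 1 \<and> trivial_hopf_power h n)
      else \<infinity>)"

definition exponent :: enat where
  "exponent =
     (if \<exists>n\<ge>1. \<forall>h. trivial_hopf_power h n
      then enat (LEAST n. n \<ge> 1 \<and> (\<forall>h. trivial_hopf_power h n))
      else \<infinity>)"

text \<open>\<open>V\<^sup>1 = e\<^bsub>\<bbbk>1\<^esub> \<rightharpoonup> V\<close>, where \<open>\<bbbk>1 = span {1}\<close>\<close>

definition unit_component :: "('b set \<Rightarrow> 'b \<Rightarrow> 'a) \<Rightarrow> 'b set \<Rightarrow> 'b set" where
  "unit_component e V = (\<lambda>h. e (span {1}) \<rightharpoonup> h) ` V"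

end

end

theory Submission
  imports Defs "HOL-Library.Function_Algebras"
begin

text \<open>
  Write \<open>u\<close> for the idempotent \<open>e\<^bsub>\<bbbk>1\<^esub>\<close>. The quotient \<open>H\<^sub>1/H\<^sub>0\<close> is a Hopf bimodule over \<open>H\<^sub>0\<close>, and
  \<open>u \<rightharpoonup> H\<^sub>1\<close> is, modulo \<open>H\<^sub>0\<close>, the space of its right coinvariants. For \<open>r\<close> in this space
  \<open>\<Delta> r = r \<otimes> 1 + \<Sum> r\<^sub>-\<^sub>1 \<otimes> r\<^sub>0\<close> modulo \<open>H\<^sub>0 \<otimes> H\<^sub>0\<close>, so that
  \<open>r\<^bsup>[n]\<^esup> = \<Sum>\<^bsub>i<n\<^esub> (r\<^sub>-\<^sub>1)\<^bsup>[i]\<^esup> r\<^sub>0\<close> modulo \<open>H\<^sub>0\<close>. The projection \<open>P m = \<Sum> S(m\<^sub>-\<^sub>1) m\<^sub>0\<close> onto the left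
  coinvariants satisfies \<open>P (x m) = \<epsilon> x \<cdot> P m\<close> for \<open>x\<close> in \<open>H\<^sub>0\<close>, whence \<open>P (r\<^bsup>[n]\<^esup>) = n \<cdot> P r\<close>. In
  characteristic \<open>0\<close> every \<open>r\<close> with \<open>P r \<noteq> 0\<close> therefore has infinite Hopf order. Such an \<open>r\<close> exists:
  otherwise \<open>r = \<Sum> r\<^sub>-\<^sub>1 P(r\<^sub>0)\<close> forces all right coinvariants to vanish, hence \<open>H\<^sub>1 = H\<^sub>0\<close> because a
  Hopf module is generated by its coinvariants. But \<open>H\<^sub>1 \<noteq> H\<^sub>0\<close> as \<open>H\<close> is not cosemisimple: every simple
  left \<open>H\<^sup>*\<close>-submodule of \<open>H\<close> lies in \<open>H\<^sub>0\<close>, and a minimal submodule properly containing \<open>H\<^sub>0\<close> lies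
  in \<open>H\<^sub>1\<close>.
\<close>

section \<open>Multilinear maps on tensor powers\<close>

lemma lookup_free_scale: "Poly_Mapping.lookup (free_scale c p) w = c * Poly_Mapping.lookup p w"
  by (simp add: free_scale_def Poly_Mapping.map.rep_eq when_def)

lemma vector_space_free_scale: "vector_space free_scale"
  by unfold_locales
    (auto intro!: poly_mapping_eqI simp: lookup_free_scale lookup_add algebra_simps)

interpretation free: vector_space "free_scale :: 'a::field \<Rightarrow> ('w \<Rightarrow>\<^sub>0 'a) \<Rightarrow> ('w \<Rightarrow>\<^sub>0 'a)"
  by (rule vector_space_free_scale)

lemma vector_space_field: "vector_space ((*) :: 'a::field \<Rightarrow> 'a \<Rightarrow> 'a)"
  by unfold_locales (auto simp: algebra_simps)

context tensor_powers
begin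

definition multilinear_on_words :: "('a \<Rightarrow> 'c::ab_group_add \<Rightarrow> 'c) \<Rightarrow> ('b list \<Rightarrow> 'c) \<Rightarrow> bool" where
  "multilinear_on_words s \<phi> \<longleftrightarrow> (\<forall>u v. Vector_Spaces.linear scale s (\<lambda>x. \<phi> (u @ [x] @ v)))"

text \<open>Words form a basis of the free space, so a map on words extends linearly by summing over
  the support; multilinearity of \<open>\<phi>\<close> is what makes the extension vanish on the
  relations.\<close>

lemma multilinear_extension:
  fixes s :: "'a \<Rightarrow> 'c::ab_group_add \<Rightarrow> 'c"
  assumes "multilinear_on_words s \<phi>"
  shows "\<exists>F. Vector_Spaces.linear free_scale s F \<and> (\<forall>w. F (word w) = \<phi> w) \<and>
    (\<forall>p\<in>free.span multilinearity_relations. F p = 0)"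
proof -
  have L: "Vector_Spaces.linear scale s (\<lambda>x. \<phi> (u @ [x] @ v))" for u v
    using assms by (simp add: multilinear_on_words_def)
  from L[of "[]" "[]"] interpret s: vector_space s by (simp add: Vector_Spaces.linear_iff)
  let ?F = "\<lambda>p. \<Sum>w\<in>Poly_Mapping.keys p. s (Poly_Mapping.lookup p w) (\<phi> w)"
  \<comment> \<open>Any finite superset of the support may index the sum, so two elements can be
    compared over the union of their supports.\<close>
  have *: "?F p = (\<Sum>w\<in>K. s (Poly_Mapping.lookup p w) (\<phi> w))"
    if "finite K" "Poly_Mapping.keys p \<subseteq> K" for p K
    by (rule sum.mono_neutral_left) (use that in \<open>auto simp: in_keys_iff\<close>)
  have lin: "Vector_Spaces.linear free_scale s ?F"
    unfolding Vector_Spaces.linear_iff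
  proof (intro conjI allI)
    fix p q :: "'b list \<Rightarrow>\<^sub>0 'a" and c
    let ?K = "Poly_Mapping.keys p \<union> Poly_Mapping.keys q"
    have "?F (p + q) = (\<Sum>w\<in>?K. s (Poly_Mapping.lookup (p + q) w) (\<phi> w))"
      by (rule *) (auto simp: keys_add[THEN subsetD] dest: keys_add[THEN subsetD])
    also have "\<dots> = (\<Sum>w\<in>?K. s (Poly_Mapping.lookup p w) (\<phi> w)) + (\<Sum>w\<in>?K. s (Poly_Mapping.lookup q w) (\<phi> w))"
      by (simp add: lookup_add s.scale_left_distrib sum.distrib)
    also have "\<dots> = ?F p + ?F q" by (subst (1 2) *[symmetric]) auto
    finally show "?F (p + q) = ?F p + ?F q" .
    have "?F (free_scale c p) = (\<Sum>w\<in>Poly_Mapping.keys p. s (Poly_Mapping.lookup (free_scale c p) w) (\<phi> w))"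
      by (rule *) (auto simp: in_keys_iff lookup_free_scale)
    then show "?F (free_scale c p) = s c (?F p)"
      by (simp add: lookup_free_scale s.scale_sum_right)
  qed (unfold_locales)
  interpret F: Vector_Spaces.linear free_scale s ?F by (rule lin)
  have word: "?F (word w) = \<phi> w" for w by (simp add: word_def)
  have rel: "?F p = 0" if "p \<in> multilinearity_relations" for p
  proof -
    from that consider u v x y where "p = word (u @ [x + y] @ v) - word (u @ [x] @ v) - word (u @ [y] @ v)"
      | u v c x where "p = word (u @ [scale c x] @ v) - free_scale c (word (u @ [x] @ v))"
      unfolding multilinearity_relations_def by blast
    then show ?thesis
    proof cases
      case 1
      have "\<phi> (u @ [x + y] @ v) = \<phi> (u @ [x] @ v) + \<phi> (u @ [y] @ v)"
        using L[of u v] unfolding Vector_Spaces.linear_iff by blast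
      then show ?thesis unfolding 1 F.diff word by simp
    next
      case 2
      have "\<phi> (u @ [scale c x] @ v) = s c (\<phi> (u @ [x] @ v))"
        using L[of u v] unfolding Vector_Spaces.linear_iff by blast
      then show ?thesis unfolding 2 F.diff F.scale word by simp
    qed
  qed
  have "?F p = 0" if "p \<in> free.span multilinearity_relations" for p
    using F.eq_0_on_span[OF rel that] by simp
  with lin word show ?thesis by blast
qed

lemma tensor_eq_iff:
  "tensor ws = tensor ws' \<longleftrightarrow>
     (\<Sum>w\<leftarrow>ws. word w) - (\<Sum>w\<leftarrow>ws'. word w) \<in> free.span multilinearity_relations"
  (is "_ \<longleftrightarrow> ?a - ?b \<in> ?R")
proof
  assume "tensor ws = tensor ws'"
  moreover have "?a \<in> tensor ws" by (simp add: tensor_def free.span_zero)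
  ultimately have "?a \<in> tensor ws'" by simp
  then show "?a - ?b \<in> ?R" by (simp add: tensor_def)
next
  assume R: "?a - ?b \<in> ?R"
  have "p - ?a \<in> ?R \<longleftrightarrow> p - ?b \<in> ?R" for p
    using free.span_add[OF _ R, of "p - ?a"] free.span_diff[OF _ R, of "p - ?b"] by auto
  then show "tensor ws = tensor ws'" by (simp add: tensor_def)
qed

text \<open>The reason why Sweedler notation is meaningful: the linear extension of
  \<open>\<phi>\<close> kills the difference of two representatives of the same coset.\<close>

lemma multilinear_sum_eq:
  assumes "multilinear_on_words s \<phi>" "tensor ws = tensor ws'"
  shows "(\<Sum>w\<leftarrow>ws. \<phi> w) = (\<Sum>w\<leftarrow>ws'. \<phi> w)"
proof -
  obtain F where F: "Vector_Spaces.linear free_scale s F" "\<And>w. F (word w) = \<phi> w"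
    "\<And>p. p \<in> free.span multilinearity_relations \<Longrightarrow> F p = 0"
    using multilinear_extension[OF assms(1)] by blast
  interpret F: Vector_Spaces.linear free_scale s F by (rule F)
  have *: "F (\<Sum>w\<leftarrow>ws. word w) = (\<Sum>w\<leftarrow>ws. \<phi> w)" for ws
    by (induction ws) (simp_all add: F F.add)
  from F(3)[OF assms(2)[unfolded tensor_eq_iff]] show ?thesis by (simp add: * F.diff)
qed

definition bilin :: "('a \<Rightarrow> 'c::ab_group_add \<Rightarrow> 'c) \<Rightarrow> ('b \<Rightarrow> 'b \<Rightarrow> 'c) \<Rightarrow> bool" where
  "bilin s \<beta> \<longleftrightarrow> (\<forall>y. Vector_Spaces.linear scale s (\<lambda>x. \<beta> x y)) \<and>
     (\<forall>x. Vector_Spaces.linear scale s (\<beta> x))"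

definition trilin :: "('a \<Rightarrow> 'c::ab_group_add \<Rightarrow> 'c) \<Rightarrow> ('b \<Rightarrow> 'b \<Rightarrow> 'b \<Rightarrow> 'c) \<Rightarrow> bool" where
  "trilin s \<gamma> \<longleftrightarrow> (\<forall>y z. Vector_Spaces.linear scale s (\<lambda>x. \<gamma> x y z)) \<and>
     (\<forall>x z. Vector_Spaces.linear scale s (\<lambda>y. \<gamma> x y z)) \<and>
     (\<forall>x y. Vector_Spaces.linear scale s (\<gamma> x y))"

lemma linear_zero: "vector_space s \<Longrightarrow> Vector_Spaces.linear scale s (\<lambda>_. 0)"
  unfolding Vector_Spaces.linear_iff using vector_space_axioms module.scale_zero_right module_iff_vector_space
  by (metis add.right_neutral)

lemma bilin_sum_eq:
  assumes "bilin s \<beta>" "tensor2 ps = tensor2 qs"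
  shows "(\<Sum>(a, b)\<leftarrow>ps. \<beta> a b) = (\<Sum>(a, b)\<leftarrow>qs. \<beta> a b)"
proof -
  \<comment> \<open>Words of length other than 2 get the value 0. Filling one slot fixes the length,
    so each slot map is a partial map of \<open>\<beta>\<close> or constantly 0.\<close>
  let ?\<phi> = "\<lambda>w. case w of [a, b] \<Rightarrow> \<beta> a b | _ \<Rightarrow> 0"
  have vs: "vector_space s" using assms(1) by (auto simp: bilin_def Vector_Spaces.linear_iff)
  have "Vector_Spaces.linear scale s (\<lambda>x. ?\<phi> (u @ [x] @ v))" for u v
  proof -
    consider a where "u = [a]" "v = []" | b where "u = []" "v = [b]" | "length u + length v \<noteq> 1"
      by (cases u; cases v) auto
    then show ?thesis
    proof cases
      case 3
      then have "(\<lambda>x. ?\<phi> (u @ [x] @ v)) = (\<lambda>_. 0)"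
        by (auto simp: fun_eq_iff split: list.split) (auto simp: append_eq_Cons_conv)
      then show ?thesis using linear_zero[OF vs] by simp
    qed (use assms(1) in \<open>auto simp: bilin_def\<close>)
  qed
  then have m: "multilinear_on_words s ?\<phi>" by (simp add: multilinear_on_words_def)
  have *: "(\<Sum>w\<leftarrow>[[a, b]. (a, b) \<leftarrow> ps]. ?\<phi> w) = (\<Sum>(a, b)\<leftarrow>ps. \<beta> a b)" for ps
    by (induction ps) auto
  show ?thesis using multilinear_sum_eq[OF m assms(2)[unfolded tensor2_def]] by (simp only: *)
qed

lemma trilin_sum_eq:
  assumes "trilin s \<gamma>"
    and "tensor [[a, b, c]. (a, b, c) \<leftarrow> ps] = tensor [[a, b, c]. (a, b, c) \<leftarrow> qs]"
  shows "(\<Sum>(a, b, c)\<leftarrow>ps. \<gamma> a b c) = (\<Sum>(a, b, c)\<leftarrow>qs. \<gamma> a b c)"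
proof -
  let ?\<phi> = "\<lambda>w. case w of [a, b, c] \<Rightarrow> \<gamma> a b c | _ \<Rightarrow> 0"
  have vs: "vector_space s" using assms(1) by (auto simp: trilin_def Vector_Spaces.linear_iff)
  have "Vector_Spaces.linear scale s (\<lambda>x. ?\<phi> (u @ [x] @ v))" for u v
  proof -
    consider a b where "u = [a, b]" "v = []" | a b where "u = [a]" "v = [b]"
      | a b where "u = []" "v = [a, b]" | "length u + length v \<noteq> 2"
      by (cases u; cases v; cases "tl u"; cases "tl v") auto
    then show ?thesis
    proof cases
      case 4
      then have "(\<lambda>x. ?\<phi> (u @ [x] @ v)) = (\<lambda>_. 0)"
        by (auto simp: fun_eq_iff split: list.split) (auto simp: append_eq_Cons_conv)
      then show ?thesis using linear_zero[OF vs] by simp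
    qed (use assms(1) in \<open>auto simp: trilin_def\<close>)
  qed
  then have m: "multilinear_on_words s ?\<phi>" by (simp add: multilinear_on_words_def)
  have *: "(\<Sum>w\<leftarrow>[[a, b, c]. (a, b, c) \<leftarrow> ps]. ?\<phi> w) = (\<Sum>(a, b, c)\<leftarrow>ps. \<gamma> a b c)" for ps
    by (induction ps) auto
  show ?thesis using multilinear_sum_eq[OF m assms(2)] by (simp only: *)
qed

text \<open>Each left factor is expanded in the basis \<open>B\<close>, scalars are moved to the
  right, and the right factors are collected by basis vector. The finite set \<open>K\<close>
  contains all basis vectors that occur.\<close>

lemma tensor2_eq_basis_expansion:
  assumes B: "independent B" "span B = UNIV"
    and K: "finite K" "K \<subseteq> B" "\<And>x y b. (x, y) \<in> set ps \<Longrightarrow> representation B x b \<noteq> 0 \<Longrightarrow> b \<in> K"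
    and bs: "distinct bs" "set bs = K"
  shows "tensor2 ps = tensor2 [(b, \<Sum>(x, y)\<leftarrow>ps. scale (representation B x b) y). b \<leftarrow> bs]"
proof -
  let ?R = "free.span multilinearity_relations"
  define eqv where "eqv p q \<longleftrightarrow> p - q \<in> ?R" for p q :: "'b list \<Rightarrow>\<^sub>0 'a"
  have refl: "eqv p p" for p by (simp add: eqv_def free.span_zero)
  have sym: "eqv p q \<Longrightarrow> eqv q p" for p q
    unfolding eqv_def using free.span_neg[of "p - q"] by simp
  have trans: "eqv p q \<Longrightarrow> eqv q r \<Longrightarrow> eqv p r" for p q r
    unfolding eqv_def using free.span_add[of "p - q" _ "q - r"] by simp
  have add: "eqv p q \<Longrightarrow> eqv p' q' \<Longrightarrow> eqv (p + p') (q + q')" for p q p' q'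
    unfolding eqv_def using free.span_add[of "p - q" _ "p' - q'"] by (simp add: algebra_simps)
  have scl: "eqv p q \<Longrightarrow> eqv (free_scale c p) (free_scale c q)" for p q c
    unfolding eqv_def using free.span_scale[of "p - q" _ c] by (simp add: free.scale_right_diff_distrib)
  have radd: "eqv (word (u @ [x + y] @ v)) (word (u @ [x] @ v) + word (u @ [y] @ v))" for u v x y
    unfolding eqv_def multilinearity_relations_def diff_diff_eq[symmetric]
    by (rule free.span_base, rule UnI1) blast
  have rscl: "eqv (word (u @ [scale c x] @ v)) (free_scale c (word (u @ [x] @ v)))" for u v c x
    unfolding eqv_def multilinearity_relations_def by (rule free.span_base, rule UnI2) blast
  have rzero: "eqv (word (u @ [0] @ v)) 0" for u v
    using rscl[of u 0 0 v] by simp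
  have rsum: "eqv (word (u @ [\<Sum>i\<in>J. f i] @ v)) (\<Sum>i\<in>J. word (u @ [f i] @ v))" if "finite J"
    for u v J and f :: "'b \<Rightarrow> 'b"
    using that
  proof induction
    case empty show ?case using rzero by simp
  next
    case (insert i J)
    then show ?case using trans[OF radd add[OF refl insert.IH]] by simp
  qed
  have esum: "eqv (\<Sum>i\<in>J. f i) (\<Sum>i\<in>J. g i)" if "finite J" "\<And>i. i \<in> J \<Longrightarrow> eqv (f i) (g i)"
    for J and f g :: "'b \<Rightarrow> ('b list \<Rightarrow>\<^sub>0 'a)"
    using that by induction (auto intro: refl add)
  have one: "eqv (word [x, y]) (\<Sum>b\<in>K. word [b, scale (representation B x b) y])"
    if "(x, y) \<in> set ps" for x y
  proof -
    have "x = (\<Sum>b\<in>{b. representation B x b \<noteq> 0}. scale (representation B x b) b)"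
      using sum_nonzero_representation_eq[of B x] B by simp
    also have "\<dots> = (\<Sum>b\<in>K. scale (representation B x b) b)"
      by (rule sum.mono_neutral_left) (use K that in auto)
    finally have x: "x = (\<Sum>b\<in>K. scale (representation B x b) b)" .
    have "eqv (word ([] @ [x] @ [y])) (\<Sum>b\<in>K. word ([] @ [scale (representation B x b) b] @ [y]))"
      by (subst x) (rule rsum[OF K(1)])
    moreover have "eqv \<dots> (\<Sum>b\<in>K. word ([b] @ [scale (representation B x b) y] @ []))"
    proof (rule esum[OF K(1)])
      fix b
      have "eqv (word ([] @ [scale (representation B x b) b] @ [y]))
              (free_scale (representation B x b) (word ([] @ [b] @ [y])))" by (rule rscl)
      moreover have "eqv (free_scale (representation B x b) (word ([b] @ [y] @ [])))
              (word ([b] @ [scale (representation B x b) y] @ []))" by (rule sym[OF rscl])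
      ultimately show "eqv (word ([] @ [scale (representation B x b) b] @ [y]))
              (word ([b] @ [scale (representation B x b) y] @ []))" using trans by simp
    qed
    ultimately show ?thesis using trans by simp
  qed
  \<comment> \<open>The induction runs over lists with entries among those of \<open>ps\<close>, so
    that \<open>K\<close> stays fixed.\<close>
  have "eqv (\<Sum>(x, y)\<leftarrow>ps'. word [x, y])
      (\<Sum>b\<in>K. word [b, \<Sum>(x, y)\<leftarrow>ps'. scale (representation B x b) y])" if "set ps' \<subseteq> set ps" for ps'
    using that
  proof (induction ps')
    case Nil
    have "eqv (\<Sum>b\<in>K. word [b, 0]) (\<Sum>b\<in>K. 0)"
      using rzero[of "[_]" "[]"] by (intro esum K) simp
    then show ?case using sym by simp
  next
    case (Cons p ps')
    obtain x y where p: "p = (x, y)" by force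
    have "eqv (word [x, y] + (\<Sum>(x, y)\<leftarrow>ps'. word [x, y]))
      ((\<Sum>b\<in>K. word [b, scale (representation B x b) y]) +
       (\<Sum>b\<in>K. word [b, \<Sum>(x, y)\<leftarrow>ps'. scale (representation B x b) y]))"
      using Cons one p by (intro add) auto
    moreover have "eqv \<dots> (\<Sum>b\<in>K. word [b, scale (representation B x b) y +
       (\<Sum>(x, y)\<leftarrow>ps'. scale (representation B x b) y)])"
      unfolding sum.distrib[symmetric] using radd[of "[_]" _ _ "[]"] by (intro esum K) (simp add: sym)
    ultimately show ?case unfolding p using trans by simp
  qed
  from this[of ps] have "eqv (\<Sum>(x, y)\<leftarrow>ps. word [x, y])
    (\<Sum>b\<leftarrow>bs. word [b, \<Sum>(x, y)\<leftarrow>ps. scale (representation B x b) y])"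
    by (simp add: sum_list_distinct_conv_sum_set bs)
  moreover have "(\<Sum>w\<leftarrow>[[a, b]. (a, b) \<leftarrow> qs]. word w) = (\<Sum>(x, y)\<leftarrow>qs. word [x, y])" for qs
    by (induction qs) auto
  ultimately show ?thesis unfolding tensor2_def tensor_eq_iff eqv_def
    by (simp add: comp_def split_def)
qed

end

section \<open>Sweedler sums\<close>

context tensor_powers
begin

section \<open>Linear algebra: closure rules, separating functionals, bases and dimension\<close>

lemma linear_comp:
  "Vector_Spaces.linear scale s g \<Longrightarrow> Vector_Spaces.linear scale scale f \<Longrightarrow>
    Vector_Spaces.linear scale s (\<lambda>x. g (f x))"
  by (simp add: Vector_Spaces.linear_iff)

lemma linear_scale_left:
  "Vector_Spaces.linear scale (*) f \<Longrightarrow> Vector_Spaces.linear scale scale (\<lambda>x. scale (f x) y)"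
  by (simp add: Vector_Spaces.linear_iff scale_left_distrib)

lemma linear_scale_right:
  "Vector_Spaces.linear scale scale f \<Longrightarrow> Vector_Spaces.linear scale scale (\<lambda>x. scale c (f x))"
  by (simp add: Vector_Spaces.linear_iff scale_right_distrib mult.commute)

lemma linear_times_left:
  "Vector_Spaces.linear scale (*) f \<Longrightarrow> Vector_Spaces.linear scale (*) (\<lambda>x. f x * (y::'a))"
  by (simp add: Vector_Spaces.linear_iff algebra_simps)

lemma linear_times_right:
  "Vector_Spaces.linear scale (*) f \<Longrightarrow> Vector_Spaces.linear scale (*) (\<lambda>x. (y::'a) * f x)"
  by (simp add: Vector_Spaces.linear_iff algebra_simps)

lemma bilinI:
  "(\<And>y. Vector_Spaces.linear scale s (\<lambda>x. \<beta> x y)) \<Longrightarrow>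
    (\<And>x. Vector_Spaces.linear scale s (\<lambda>y. \<beta> x y)) \<Longrightarrow> bilin s \<beta>"
  by (simp add: bilin_def)

lemma trilinI:
  "(\<And>y z. Vector_Spaces.linear scale s (\<lambda>x. \<gamma> x y z)) \<Longrightarrow>
    (\<And>x z. Vector_Spaces.linear scale s (\<lambda>y. \<gamma> x y z)) \<Longrightarrow>
    (\<And>x y. Vector_Spaces.linear scale s (\<lambda>z. \<gamma> x y z)) \<Longrightarrow> trilin s \<gamma>"
  by (simp add: trilin_def)

lemma linear_list_sum:
  assumes "Vector_Spaces.linear s t F"
  shows "F (\<Sum>(a, b)\<leftarrow>ps. \<beta> a b) = (\<Sum>(a, b)\<leftarrow>ps. F (\<beta> a b))"
proof -
  interpret F: Vector_Spaces.linear s t F by (rule assms)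
  show ?thesis by (induction ps) (auto simp: F.add)
qed

lemma list_sum_in_subspace:
  "subspace V \<Longrightarrow> (\<And>a b. (a, b) \<in> set ps \<Longrightarrow> \<beta> a b \<in> V) \<Longrightarrow> (\<Sum>(a, b)\<leftarrow>ps. \<beta> a b) \<in> V"
  by (induction ps) (auto intro: subspace_0 subspace_add)

lemma list_sum_diff:
  "(\<Sum>(a, b)\<leftarrow>ps. \<beta> a b) - (\<Sum>(a, b)\<leftarrow>ps. \<beta>' a b) = (\<Sum>(a, b)\<leftarrow>ps. \<beta> a b - \<beta>' a b :: 'c::ab_group_add)"
  by (induction ps) auto

text \<open>A basis of \<open>V\<close> stays independent after adjoining \<open>y\<close>, so a
  functional can be prescribed as 1 at \<open>y\<close> and 0 on that basis.\<close>

lemma separating_functional: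
  assumes "subspace V" "y \<notin> V"
  obtains f where "Vector_Spaces.linear scale (*) f" "\<And>v. v \<in> V \<Longrightarrow> f v = 0" "f y \<noteq> 0"
proof -
  obtain B where B: "B \<subseteq> V" "independent B" "V \<subseteq> span B"
    using maximal_independent_subset by blast
  have sB: "span B = V" using B assms by (simp add: span_minimal subset_antisym)
  with assms B have i: "independent (insert y B)" by (simp add: independent_insertI)
  interpret p: vector_space_pair scale "(*) :: 'a \<Rightarrow> 'a \<Rightarrow> 'a"
    by (simp add: vector_space_pair_def vector_space_field vector_space_axioms)
  obtain f where f: "Vector_Spaces.linear scale (*) f" "\<forall>x\<in>insert y B. f x = (if x = y then 1 else 0)"
    using p.linear_independent_extend[OF i, of "\<lambda>x. if x = y then 1 else 0"] by blast
  interpret f: Vector_Spaces.linear scale "(*)" f by (rule f)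
  have "f v = 0" if "v \<in> V" for v
    by (rule f.eq_0_on_span[of B]) (use that f B assms sB in auto)
  with f show ?thesis using that by auto
qed

lemma linear_projection:
  assumes "subspace V"
  obtains p where "Vector_Spaces.linear scale scale p" "\<And>x. p x \<in> V" "\<And>x. x \<in> V \<Longrightarrow> p x = x"
proof -
  interpret p: vector_space_pair scale scale
    by (simp add: vector_space_pair_def vector_space_axioms)
  have "\<exists>g. g ` UNIV \<subseteq> V \<and> Vector_Spaces.linear scale scale g \<and> (\<forall>v\<in>V. g (id v) = v)"
    by (rule p.linear_exists_left_inverse_on) (use assms linear_id linear_ident in auto)
  then show ?thesis using that by auto
qed

lemma subspace_basis:
  assumes "subspace V"
  obtains B where "B \<subseteq> V" "independent B" "span B = V"
  by (metis assms maximal_independent_subset span_minimal subset_antisym)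

lemma linear_stable_span:
  assumes "Vector_Spaces.linear scale scale F" "\<And>x. x \<in> X \<Longrightarrow> F x \<in> span X" "x \<in> span X"
  shows "F x \<in> span X"
proof -
  interpret F: Vector_Spaces.linear scale scale F by (rule assms)
  show ?thesis using assms(3)
    by (induction rule: span_induct_alt) (auto simp: F.zero F.add F.scale span_zero span_add span_scale assms(2))
qed

lemma subspace_of_finite_dimensional:
  assumes "finite F" "subspace V" "V \<subseteq> span F"
  shows "\<exists>B. finite B \<and> independent B \<and> B \<subseteq> V \<and> span B = V \<and> card B = dim V"
proof -
  obtain B where B: "B \<subseteq> V" "independent B" "V \<subseteq> span B" "card B = dim V"
    using basis_exists by blast
  moreover have "finite B" using independent_span_bound[OF assms(1) B(2)] B(1) assms(3) by auto
  ultimately show ?thesis using assms(2) by (metis span_minimal subset_antisym)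
qed

lemma dim_strict_mono_finite:
  assumes "finite F" "V \<subset> W" "subspace V" "subspace W" "W \<subseteq> span F"
  shows "dim V < dim W"
proof -
  obtain B where B: "finite B" "independent B" "B \<subseteq> V" "span B = V" "card B = dim V"
    using subspace_of_finite_dimensional[OF assms(1,3)] assms by blast
  obtain C where C: "finite C" "independent C" "C \<subseteq> W" "span C = W" "card C = dim W"
    using subspace_of_finite_dimensional[OF assms(1,4,5)] by blast
  obtain w where w: "w \<in> W" "w \<notin> V" using assms(2) by blast
  have "independent (insert w B)" using w B by (intro independent_insertI) auto
  moreover have "insert w B \<subseteq> span C" using w B C assms(2) by auto
  ultimately have "card (insert w B) \<le> card C" using independent_span_bound[OF C(1)] by blast
  moreover have "w \<notin> B" using w B by blast
  ultimately show ?thesis using B C by simp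
qed

lemma linear_fun_zero: "Vector_Spaces.linear s t f \<Longrightarrow> f 0 = 0"
  using module_hom.zero module_hom_iff_linear by metis

text \<open>A pair with right factor 0 represents 0; dropping such pairs lets the membership tests
  below ignore vanishing coefficients.\<close>

lemma tensor2_filter_nonzero: "tensor2 ps = tensor2 [p \<leftarrow> ps. snd p \<noteq> 0]"
proof -
  have 0: "word [a, 0] \<in> free.span multilinearity_relations" for a
  proof -
    have "word ([a] @ [scale 0 0] @ []) - free_scale 0 (word ([a] @ [0] @ []))
      \<in> free.span multilinearity_relations"
      unfolding multilinearity_relations_def by (rule free.span_base, rule UnI2) blast
    then show ?thesis by simp
  qed
  have "(\<Sum>(a, b)\<leftarrow>ps. word [a, b]) - (\<Sum>(a, b)\<leftarrow>[p \<leftarrow> ps. snd p \<noteq> 0]. word [a, b])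
    \<in> free.span multilinearity_relations"
  proof (induction ps)
    case (Cons p ps)
    then show ?case using free.span_add[OF 0 Cons.IH]
      by (cases "snd p = 0") (simp_all add: split_def add_diff_eq)
  qed (simp add: free.span_zero)
  then show ?thesis unfolding tensor2_def tensor_eq_iff by (simp add: comp_def split_def)
qed

end

context coalgebra
begin

section \<open>Independence of the chosen decomposition, coassociativity and counit\<close>

lemma tensor2_sweedler: "tensor2 (sweedler (\<Delta> h)) = \<Delta> h"
proof -
  have "\<exists>ps. tensor2 ps = \<Delta> h" using comult_in[of h] by (auto simp: tensors_def)
  then show ?thesis unfolding sweedler_def by (rule someI_ex)
qed

text \<open>The chosen decomposition only stops mattering when \<open>\<beta>\<close> is bilinear,
  hence the linearity hypotheses in the rules below.\<close>

definition sw :: "('b \<Rightarrow> 'b \<Rightarrow> 'c::comm_monoid_add) \<Rightarrow> 'b \<Rightarrow> 'c" where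
  "sw \<beta> h = (\<Sum>(a, b)\<leftarrow>sweedler (\<Delta> h). \<beta> a b)"

lemma sw_eq: "bilin s \<beta> \<Longrightarrow> \<Delta> h = tensor2 ps \<Longrightarrow> sw \<beta> h = (\<Sum>(a, b)\<leftarrow>ps. \<beta> a b)"
  unfolding sw_def using bilin_sum_eq tensor2_sweedler by metis

lemma linear_sw:
  assumes "bilin s \<beta>"
  shows "Vector_Spaces.linear scale s (sw \<beta>)"
  unfolding Vector_Spaces.linear_iff
proof (intro conjI allI)
  have L: "Vector_Spaces.linear scale s (\<lambda>x. \<beta> x y)" for y using assms by (simp add: bilin_def)
  then show s: "vector_space s" by (simp add: Vector_Spaces.linear_iff)
  interpret s: vector_space s by (rule s)
  fix x y c
  show "sw \<beta> (x + y) = sw \<beta> x + sw \<beta> y"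
    by (subst sw_eq[OF assms comult_add]) (simp add: sw_def)
  have "(\<Sum>(a, b)\<leftarrow>[(scale c a, b). (a, b) \<leftarrow> ps]. \<beta> a b) = s c (\<Sum>(a, b)\<leftarrow>ps. \<beta> a b)" for ps
    using L by (induction ps) (auto simp: s.scale_right_distrib Vector_Spaces.linear_iff)
  then show "sw \<beta> (scale c x) = s c (sw \<beta> x)"
    by (subst sw_eq[OF assms comult_scale]) (simp add: sw_def)
qed (rule vector_space_axioms)

lemma linear_sw_const:
  assumes "vector_space s" "\<And>a b. Vector_Spaces.linear scale s (\<lambda>x. \<phi> x a b)"
  shows "Vector_Spaces.linear scale s (\<lambda>x. sw (\<lambda>a b. \<phi> x a b) h)"
proof -
  interpret s: vector_space s by (rule assms)
  have "Vector_Spaces.linear scale s (\<lambda>x. \<Sum>(a, b)\<leftarrow>ps. \<phi> x a b)" for ps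
    using assms by (induction ps)
      (auto simp: Vector_Spaces.linear_iff s.scale_right_distrib vector_space_axioms algebra_simps)
  then show ?thesis by (simp add: sw_def)
qed

lemma linear_sw_comp:
  "bilin s (\<lambda>a b. \<beta> a b) \<Longrightarrow> Vector_Spaces.linear scale scale f \<Longrightarrow>
    Vector_Spaces.linear scale s (\<lambda>x. sw (\<lambda>a b. \<beta> a b) (f x))"
  by (rule linear_comp[OF linear_sw])

text \<open>Applied repeatedly, these rules discharge linearity conditions by following the syntax
  of a Sweedler expression.\<close>

lemmas linear_rules = bilinI trilinI linear_ident linear_scale_left linear_scale_right
  linear_times_left linear_times_right
  linear_sw_const[OF vector_space_axioms] linear_sw_const[OF vector_space_field] linear_sw_comp

lemma sw_coassoc:
  assumes "trilin s \<gamma>"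
  shows "sw (\<lambda>a b. sw (\<lambda>a1 a2. \<gamma> a1 a2 b) a) h = sw (\<lambda>a b. sw (\<lambda>b1 b2. \<gamma> a b1 b2) b) h"
proof -
  \<comment> \<open>Nested sums are flattened into sums over lists of triples, the form to which
    \<open>trilin_sum_eq\<close> and \<open>coassoc\<close> apply.\<close>
  have *: "(\<Sum>(a, b, c)\<leftarrow>[(a1, a2, b). (a, b) \<leftarrow> ps, (a1, a2) \<leftarrow> f a]. \<gamma> a b c) =
    (\<Sum>(a, b)\<leftarrow>ps. \<Sum>(a1, a2)\<leftarrow>f a. \<gamma> a1 a2 b)" for ps f
    by (induction ps) (auto simp: comp_def split_def)
  have **: "(\<Sum>(a, b, c)\<leftarrow>[(a, b1, b2). (a, b) \<leftarrow> ps, (b1, b2) \<leftarrow> f b]. \<gamma> a b c) =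
    (\<Sum>(a, b)\<leftarrow>ps. \<Sum>(b1, b2)\<leftarrow>f b. \<gamma> a b1 b2)" for ps f
    by (induction ps) (auto simp: comp_def split_def)
  show ?thesis unfolding sw_def
    unfolding *[symmetric] **[symmetric]
    by (rule trilin_sum_eq[OF assms])
       (use coassoc[of h] in \<open>simp add: map_concat comp_def split_def\<close>)
qed

lemma linear_of_sw:
  "Vector_Spaces.linear s t F \<Longrightarrow> F (sw \<beta> h) = sw (\<lambda>a b. F (\<beta> a b)) h"
  unfolding sw_def by (rule linear_list_sum)

lemma sw_swap:
  "sw (\<lambda>a b. sw (\<lambda>c d. \<phi> a b c d) y) x = sw (\<lambda>c d. sw (\<lambda>a b. \<phi> a b c d) x) y"
proof -
  have "(\<Sum>(a, b)\<leftarrow>ps. \<Sum>(c, d)\<leftarrow>qs. \<phi> a b c d) = (\<Sum>(c, d)\<leftarrow>qs. \<Sum>(a, b)\<leftarrow>ps. \<phi> a b c d)" for ps qs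
    by (induction ps) (auto simp: split_def sum_list_addf)
  then show ?thesis by (simp add: sw_def)
qed

lemma sw_counit_left:
  assumes "Vector_Spaces.linear scale s g"
  shows "sw (\<lambda>a b. s (\<epsilon> a) (g b)) h = g h"
proof -
  have "g (sw (\<lambda>a b. scale (\<epsilon> a) b) h) = sw (\<lambda>a b. g (scale (\<epsilon> a) b)) h"
    by (rule linear_of_sw[OF assms])
  then show ?thesis using assms counit_left[of h] by (simp add: Vector_Spaces.linear_iff sw_def)
qed

lemma sw_counit_right:
  assumes "Vector_Spaces.linear scale s g"
  shows "sw (\<lambda>a b. s (\<epsilon> b) (g a)) h = g h"
proof -
  have "g (sw (\<lambda>a b. scale (\<epsilon> b) a) h) = sw (\<lambda>a b. g (scale (\<epsilon> b) a)) h"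
    by (rule linear_of_sw[OF assms])
  then show ?thesis using assms counit_right[of h] by (simp add: Vector_Spaces.linear_iff sw_def)
qed

text \<open>A decomposition with all terms in \<open>X\<close> may replace the chosen one, so
  congruence modulo \<open>V\<close> only has to be checked on pairs from \<open>X\<close>. This is
  the basic tool for computing modulo the coradical.\<close>

lemma sw_diff_in_subspace:
  assumes "\<Delta> h \<in> tensors X" "bilin scale \<beta>" "bilin scale \<beta>'" "subspace V"
    and "\<And>a b. (a, b) \<in> X \<Longrightarrow> \<beta> a b - \<beta>' a b \<in> V"
  shows "sw \<beta> h - sw \<beta>' h \<in> V"
proof -
  obtain ps where ps: "\<Delta> h = tensor2 ps" "set ps \<subseteq> X" using assms(1) by (auto simp: tensors_def)
  show ?thesis
    unfolding sw_eq[OF assms(2) ps(1)] sw_eq[OF assms(3) ps(1)] list_sum_diff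
    by (rule list_sum_in_subspace) (use assms ps in auto)
qed

lemma sw_in_subspace:
  assumes "\<Delta> h \<in> tensors X" "bilin scale \<beta>" "subspace V" "\<And>a b. (a, b) \<in> X \<Longrightarrow> \<beta> a b \<in> V"
  shows "sw \<beta> h \<in> V"
proof -
  obtain ps where ps: "\<Delta> h = tensor2 ps" "set ps \<subseteq> X" using assms(1) by (auto simp: tensors_def)
  show ?thesis
    unfolding sw_eq[OF assms(2) ps(1)] by (rule list_sum_in_subspace) (use assms ps in auto)
qed

lemma sw_cong_tensors:
  assumes "\<Delta> h \<in> tensors X" "bilin s \<beta>" "bilin s \<beta>'"
    and "\<And>a b. (a, b) \<in> X \<Longrightarrow> \<beta> a b = \<beta>' a b"
  shows "sw \<beta> h = sw \<beta>' h"
proof -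
  obtain ps where ps: "\<Delta> h = tensor2 ps" "set ps \<subseteq> X" using assms(1) by (auto simp: tensors_def)
  show ?thesis unfolding sw_eq[OF assms(2) ps(1)] sw_eq[OF assms(3) ps(1)]
    using ps(2) assms(4) by (intro arg_cong[where f = sum_list] map_cong) auto
qed

subsection \<open>The actions of the dual algebra\<close>

definition hit_right :: "'b \<Rightarrow> ('b \<Rightarrow> 'a) \<Rightarrow> 'b"  (infixl \<open>\<leftharpoonup>\<close> 70) where
  "h \<leftharpoonup> f = sw (\<lambda>a b. scale (f a) b) h"

lemma hit_sw: "f \<rightharpoonup> h = sw (\<lambda>a b. scale (f b) a) h"
  by (simp add: hit_def sw_def)

lemma conv_sw: "conv f g = sw (\<lambda>a b. f a * g b)"
  by (simp add: conv_def sw_def fun_eq_iff)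

lemma dual_linear: "f \<in> dual \<Longrightarrow> Vector_Spaces.linear scale (*) f"
  by (simp add: dual_def)

lemma counit_dual: "\<epsilon> \<in> dual"
  by (simp add: dual_def counit_linear)

lemmas linear_dual = linear_comp[OF dual_linear]

lemma conv_dual: "f \<in> dual \<Longrightarrow> g \<in> dual \<Longrightarrow> conv f g \<in> dual"
  unfolding conv_sw dual_def mem_Collect_eq
  by (intro linear_sw) (rule linear_rules linear_dual | assumption | simp add: dual_def)+

lemma linear_hit: "f \<in> dual \<Longrightarrow> Vector_Spaces.linear scale scale (\<lambda>h. f \<rightharpoonup> h)"
  unfolding hit_sw by (intro linear_sw) (rule linear_rules dual_linear | assumption)+

lemma linear_hit_right: "f \<in> dual \<Longrightarrow> Vector_Spaces.linear scale scale (\<lambda>h. h \<leftharpoonup> f)"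
  unfolding hit_right_def by (intro linear_sw) (rule linear_rules dual_linear | assumption)+

text \<open>The left action is the transpose of right multiplication in the dual algebra; this turns
  statements about the module \<open>H\<close> into identities of convolution products.\<close>

lemma dual_hit: "g \<in> dual \<Longrightarrow> g (f \<rightharpoonup> h) = conv g f h"
  unfolding hit_sw conv_sw
  by (subst linear_of_sw[OF dual_linear]) (simp_all add: dual_def Vector_Spaces.linear_iff mult.commute)

lemma dual_hit_right: "g \<in> dual \<Longrightarrow> g (h \<leftharpoonup> f) = conv f g h"
  unfolding hit_right_def conv_sw
  by (subst linear_of_sw[OF dual_linear]) (simp_all add: dual_def Vector_Spaces.linear_iff)

lemma hit_counit: "\<epsilon> \<rightharpoonup> h = h"
  using counit_right by (simp add: hit_def)

lemma hit_right_counit: "h \<leftharpoonup> \<epsilon> = h"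
  using counit_left by (simp add: hit_right_def sw_def)

lemma conv_counit_left: "f \<in> dual \<Longrightarrow> conv \<epsilon> f = f"
  by (metis dual_hit_right hit_right_counit ext)

lemma scale_sw: "scale c (sw \<beta> h) = sw (\<lambda>a b. scale c (\<beta> a b)) h"
  by (rule linear_of_sw[OF linear_scale_self])

lemma sw_scale_left: "scale (sw \<phi> h) x = sw (\<lambda>a b. scale (\<phi> a b) x) h"
proof -
  have "Vector_Spaces.linear (*) scale (\<lambda>c. scale c x)"
    by (simp add: Vector_Spaces.linear_iff scale_left_distrib vector_space_axioms vector_space_field)
  from linear_of_sw[OF this] show ?thesis .
qed

lemma hit_hit:
  assumes "f \<in> dual" "g \<in> dual"
  shows "f \<rightharpoonup> (g \<rightharpoonup> h) = conv f g \<rightharpoonup> h"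
proof -
  have "f \<rightharpoonup> (g \<rightharpoonup> h) = sw (\<lambda>a b. f \<rightharpoonup> scale (g b) a) h"
    unfolding hit_sw[of g] by (rule linear_of_sw[OF linear_hit[OF assms(1)]])
  also have "\<dots> = sw (\<lambda>a b. sw (\<lambda>a1 a2. scale (f a2 * g b) a1) a) h"
    using linear_hit[OF assms(1)]
    by (simp add: Vector_Spaces.linear_iff) (simp add: hit_sw scale_sw mult.commute)
  also have "\<dots> = sw (\<lambda>a b. sw (\<lambda>b1 b2. scale (f b1 * g b2) a) b) h"
    by (rule sw_coassoc) (rule linear_rules dual_linear | rule assms)+
  finally show ?thesis by (simp add: hit_sw conv_sw sw_scale_left)
qed

lemma hit_right_hit_right:
  assumes "f \<in> dual" "g \<in> dual"
  shows "h \<leftharpoonup> f \<leftharpoonup> g = h \<leftharpoonup> conv f g"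
proof -
  have "h \<leftharpoonup> f \<leftharpoonup> g = sw (\<lambda>a b. scale (f a) b \<leftharpoonup> g) h"
    unfolding hit_right_def[of _ f] by (rule linear_of_sw[OF linear_hit_right[OF assms(2)]])
  also have "\<dots> = sw (\<lambda>a b. sw (\<lambda>b1 b2. scale (f a * g b1) b2) b) h"
    using linear_hit_right[OF assms(2)]
    by (simp add: Vector_Spaces.linear_iff) (simp add: hit_right_def scale_sw)
  also have "\<dots> = sw (\<lambda>a b. sw (\<lambda>a1 a2. scale (f a1 * g a2) b) a) h"
    by (rule sw_coassoc[symmetric]) (rule linear_rules dual_linear | rule assms)+
  finally show ?thesis by (simp add: hit_right_def conv_sw sw_scale_left)
qed

lemma hit_hit_right:
  assumes "f \<in> dual" "g \<in> dual"
  shows "f \<rightharpoonup> (h \<leftharpoonup> g) = (f \<rightharpoonup> h) \<leftharpoonup> g"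
proof -
  have "f \<rightharpoonup> (h \<leftharpoonup> g) = sw (\<lambda>a b. f \<rightharpoonup> scale (g a) b) h"
    unfolding hit_right_def by (rule linear_of_sw[OF linear_hit[OF assms(1)]])
  also have "\<dots> = sw (\<lambda>a b. sw (\<lambda>b1 b2. scale (g a * f b2) b1) b) h"
    using linear_hit[OF assms(1)]
    by (simp add: Vector_Spaces.linear_iff) (simp add: hit_sw scale_sw)
  also have "\<dots> = sw (\<lambda>a b. sw (\<lambda>a1 a2. scale (g a1 * f b) a2) a) h"
    by (rule sw_coassoc[symmetric]) (rule linear_rules dual_linear | rule assms)+
  also have "\<dots> = sw (\<lambda>a b. scale (f b) a \<leftharpoonup> g) h"
    using linear_hit_right[OF assms(2)]
    by (simp add: Vector_Spaces.linear_iff) (simp add: hit_right_def scale_sw mult.commute)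
  also have "\<dots> = (f \<rightharpoonup> h) \<leftharpoonup> g"
    unfolding hit_sw by (rule linear_of_sw[OF linear_hit_right[OF assms(2)], symmetric])
  finally show ?thesis .
qed

lemma conv_assoc:
  assumes "f \<in> dual" "g \<in> dual" "k \<in> dual"
  shows "conv (conv f g) k = conv f (conv g k)"
proof
  fix h
  have "conv (conv f g) k h = f (g \<rightharpoonup> (k \<rightharpoonup> h))"
    by (simp add: dual_hit assms conv_dual)
  also have "\<dots> = conv f (conv g k) h" by (simp add: hit_hit dual_hit assms)
  finally show "conv (conv f g) k h = conv f (conv g k) h" .
qed

section \<open>Detecting elements and subspaces of the tensor square by functionals\<close>

lemma dual_eqI:
  assumes "\<And>f. f \<in> dual \<Longrightarrow> f x = f y"
  shows "x = y"
proof (rule ccontr)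
  assume "x \<noteq> y"
  then have "x - y \<notin> {0}" by simp
  from separating_functional[OF subspace_single_0 this] obtain f where
    f: "Vector_Spaces.linear scale (*) f" "f (x - y) \<noteq> 0" by blast
  interpret f: Vector_Spaces.linear scale "(*)" f by (rule f)
  from f(2) assms[of f] f(1) show False by (simp add: f.diff dual_def)
qed

text \<open>Writing \<open>b'\<close> for the coordinate functional of \<open>b\<close>, the basis
  expansion reads \<open>\<Delta> h = \<Sum>b \<otimes> (h \<leftharpoonup> b')\<close>. Membership
  thus becomes a condition on the nonzero coefficients.\<close>

lemma comult_in_tensorsI:
  assumes "independent B" "span B = UNIV"
    and X: "\<And>b. b \<in> B \<Longrightarrow> h \<leftharpoonup> (\<lambda>x. representation B x b) \<noteq> 0 \<Longrightarrow>
      (b, h \<leftharpoonup> (\<lambda>x. representation B x b)) \<in> X"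
  shows "\<Delta> h \<in> tensors X"
proof -
  let ?ps = "sweedler (\<Delta> h)" and ?y = "\<lambda>b. h \<leftharpoonup> (\<lambda>x. representation B x b)"
  define K where "K = (\<Union>(x, y)\<in>set ?ps. {b. representation B x b \<noteq> 0})"
  have "finite K" unfolding K_def by (auto intro!: finite_representation)
  then obtain bs where bs: "distinct bs" "set bs = K" using finite_distinct_list by metis
  have KB: "K \<subseteq> B" unfolding K_def using representation_ne_zero by auto
  have "tensor2 ?ps = tensor2 [(b, \<Sum>(x, y)\<leftarrow>?ps. scale (representation B x b) y). b \<leftarrow> bs]"
    by (rule tensor2_eq_basis_expansion[OF assms(1,2) \<open>finite K\<close> KB _ bs]) (auto simp: K_def)
  then have "\<Delta> h = tensor2 [(b, ?y b). b \<leftarrow> bs]"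
    by (simp add: tensor2_sweedler hit_right_def sw_def)
  also have "\<dots> = tensor2 [p \<leftarrow> [(b, ?y b). b \<leftarrow> bs]. snd p \<noteq> 0]"
    by (rule tensor2_filter_nonzero)
  finally have "\<Delta> h = tensor2 [p \<leftarrow> [(b, ?y b). b \<leftarrow> bs]. snd p \<noteq> 0]" .
  moreover have "set [p \<leftarrow> [(b, ?y b). b \<leftarrow> bs]. snd p \<noteq> 0] \<subseteq> X"
    using X bs(2) KB by auto
  ultimately show ?thesis unfolding tensors_def by blast
qed

lemma representation_dual: "independent B \<Longrightarrow> span B = UNIV \<Longrightarrow> (\<lambda>x. representation B x b) \<in> dual"
  unfolding dual_def by (simp add: linear_representation)

lemma representation_outside:
  assumes "independent B" "B' \<subseteq> B" "x \<in> span B'" "b \<notin> B'"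
  shows "representation B x b = 0"
  using representation_extend[OF assms(1,3,2)] representation_ne_zero[of B' x b] assms(4) by auto

lemma tensors_mono: "X \<subseteq> Y \<Longrightarrow> t \<in> tensors X \<Longrightarrow> t \<in> tensors Y"
  by (auto simp: tensors_def)

end

section \<open>The first term of the coradical filtration\<close>

context coalgebra
begin

text \<open>A basis of \<open>D\<close> is extended to one of \<open>H\<close>. Coefficients at the
  added basis vectors vanish by stability under the left action; the others lie in \<open>D\<close>
  by stability under the right action. With the converse below, subcoalgebras are exactly the
  sub-bimodules over the dual algebra.\<close>

lemma subcoalgebraI:
  assumes "subspace D" "\<And>f d. f \<in> dual \<Longrightarrow> d \<in> D \<Longrightarrow> f \<rightharpoonup> d \<in> D"
    "\<And>f d. f \<in> dual \<Longrightarrow> d \<in> D \<Longrightarrow> d \<leftharpoonup> f \<in> D"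
  shows "subcoalgebra D"
  unfolding subcoalgebra_def
proof (intro conjI ballI)
  fix h assume h: "h \<in> D"
  obtain B0 where B0: "B0 \<subseteq> D" "independent B0" "span B0 = D" using subspace_basis[OF assms(1)] .
  let ?B = "extend_basis B0"
  have B: "independent ?B" "span ?B = UNIV" "B0 \<subseteq> ?B"
    using B0(2) independent_extend_basis span_extend_basis extend_basis_superset by auto
  show "\<Delta> h \<in> tensors (D \<times> D)"
  proof (rule comult_in_tensorsI[OF B(1,2)])
    fix b assume "b \<in> ?B" and ne: "h \<leftharpoonup> (\<lambda>x. representation ?B x b) \<noteq> 0"
    let ?f = "\<lambda>x. representation ?B x b"
    have f: "?f \<in> dual" using representation_dual B by blast
    have "b \<in> B0"
    proof (rule ccontr)
      assume "b \<notin> B0"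
      then have "?f d = 0" if "d \<in> D" for d
        using representation_outside[OF B(1,3)] B0 that by simp
      \<comment> \<open>\<open>g (h \<leftharpoonup> ?f) = ?f (g \<rightharpoonup> h)\<close>, and
        \<open>g \<rightharpoonup> h\<close> lies in \<open>D\<close>, where \<open>?f\<close>
        vanishes.\<close>
      then have "g (h \<leftharpoonup> ?f) = g 0" if "g \<in> dual" for g
        using that assms(2)[OF that h] dual_hit_right[OF that] dual_hit[OF f] dual_linear[OF that]
          module_hom.zero module_hom_iff_linear by metis
      with dual_eqI ne show False by blast
    qed
    then show "(b, h \<leftharpoonup> ?f) \<in> D \<times> D" using B0 assms(3)[OF f h] by auto
  qed
qed (rule assms)

lemma bilin_hit: "f \<in> dual \<Longrightarrow> bilin scale (\<lambda>a b. scale (f b) a)"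
  by (rule linear_rules dual_linear | assumption)+

lemma bilin_hit_right: "f \<in> dual \<Longrightarrow> bilin scale (\<lambda>a b. scale (f a) b)"
  by (rule linear_rules dual_linear | assumption)+

lemma subcoalgebra_hit: "subcoalgebra D \<Longrightarrow> f \<in> dual \<Longrightarrow> d \<in> D \<Longrightarrow> f \<rightharpoonup> d \<in> D"
  unfolding hit_sw subcoalgebra_def
  by (rule sw_in_subspace[where X = "D \<times> D"]) (auto intro: subspace_scale simp: bilin_hit)

lemma subcoalgebra_hit_right: "subcoalgebra D \<Longrightarrow> f \<in> dual \<Longrightarrow> d \<in> D \<Longrightarrow> d \<leftharpoonup> f \<in> D"
  unfolding hit_right_def subcoalgebra_def
  by (rule sw_in_subspace[where X = "D \<times> D"]) (auto intro: subspace_scale simp: bilin_hit_right)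

section \<open>The coradical, its annihilator, and the first filtration term\<close>

lemma subspace_coradical: "subspace coradical"
  by (simp add: coradical_def)

lemma subcoalgebra_coradical: "subcoalgebra coradical"
proof (rule subcoalgebraI[OF subspace_coradical])
  fix f d assume f: "f \<in> dual" and d: "d \<in> coradical"
  show "f \<rightharpoonup> d \<in> coradical" unfolding coradical_def
    by (rule linear_stable_span[OF linear_hit[OF f]])
      (use subcoalgebra_hit[OF _ f] d in \<open>auto simp: coradical_def simple_subcoalgebras_def intro!: span_base\<close>)
  show "d \<leftharpoonup> f \<in> coradical" unfolding coradical_def
    by (rule linear_stable_span[OF linear_hit_right[OF f]])
      (use subcoalgebra_hit_right[OF _ f] d in \<open>auto simp: coradical_def simple_subcoalgebras_def intro!: span_base\<close>)
qed

text \<open>Classically this is the Jacobson radical of the dual algebra.\<close>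

definition coradical_annihilator :: "('b \<Rightarrow> 'a) set" where
  "coradical_annihilator = {f \<in> dual. \<forall>x\<in>coradical. f x = 0}"

text \<open>\<open>conv f g x = f (g \<rightharpoonup> x)\<close> and
  \<open>conv g f x = f (x \<leftharpoonup> g)\<close>, and both actions preserve the coradical
  because it is a subcoalgebra.\<close>

lemma coradical_annihilator_conv:
  assumes "f \<in> coradical_annihilator" "g \<in> dual"
  shows "conv f g \<in> coradical_annihilator" "conv g f \<in> coradical_annihilator"
proof -
  have f: "f \<in> dual" "\<And>x. x \<in> coradical \<Longrightarrow> f x = 0"
    using assms by (auto simp: coradical_annihilator_def)
  have "conv f g x = 0" "conv g f x = 0" if "x \<in> coradical" for x
    using f(2)[OF subcoalgebra_hit[OF subcoalgebra_coradical assms(2) that]]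
      f(2)[OF subcoalgebra_hit_right[OF subcoalgebra_coradical assms(2) that]]
    by (simp_all add: dual_hit dual_hit_right f(1))
  then show "conv f g \<in> coradical_annihilator" "conv g f \<in> coradical_annihilator"
    by (simp_all add: coradical_annihilator_def conv_dual f assms)
qed

lemma in_coradicalI:
  assumes "\<And>f. f \<in> coradical_annihilator \<Longrightarrow> f y = 0"
  shows "y \<in> coradical"
proof (rule ccontr)
  assume "y \<notin> coradical"
  from separating_functional[OF subspace_coradical this] obtain f where
    "Vector_Spaces.linear scale (*) f" "\<And>v. v \<in> coradical \<Longrightarrow> f v = 0" "f y \<noteq> 0" by blast
  with assms[of f] show False by (simp add: coradical_annihilator_def dual_def)
qed

lemma dual_zero: "f \<in> dual \<Longrightarrow> f 0 = 0"
  using dual_linear linear_fun_zero by blast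

text \<open>Forwards, each term of \<open>\<Delta> h\<close> has a factor killed by \<open>f\<close>
  or \<open>g\<close>. Backwards, a coordinate functional outside a basis of the coradical lies in
  the annihilator, so its coefficient is killed by the whole annihilator and hence lies in the
  coradical.\<close>

lemma filtration_1_iff:
  "h \<in> coradical_filtration 1 \<longleftrightarrow>
    (\<forall>f\<in>coradical_annihilator. \<forall>g\<in>coradical_annihilator. conv f g h = 0)"
proof
  assume "h \<in> coradical_filtration 1"
  then have h: "\<Delta> h \<in> tensors (UNIV \<times> coradical \<union> coradical \<times> UNIV)" by simp
  show "\<forall>f\<in>coradical_annihilator. \<forall>g\<in>coradical_annihilator. conv f g h = 0"
  proof (intro ballI)
    fix f g assume fg: "f \<in> coradical_annihilator" "g \<in> coradical_annihilator"
    then have d: "f \<in> dual" "g \<in> dual" by (auto simp: coradical_annihilator_def)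
    have b: "bilin (*) (\<lambda>a b. f a * g b)" "bilin (*) (\<lambda>a b. 0 :: 'a)"
      by (rule linear_rules dual_linear d linear_zero[OF vector_space_field])+
    have "conv f g h = sw (\<lambda>a b. 0) h" unfolding conv_sw
      by (rule sw_cong_tensors[OF h b]) (use fg in \<open>auto simp: coradical_annihilator_def\<close>)
    then show "conv f g h = 0" by (simp add: sw_def split_def)
  qed
next
  assume *: "\<forall>f\<in>coradical_annihilator. \<forall>g\<in>coradical_annihilator. conv f g h = 0"
  obtain B0 where B0: "B0 \<subseteq> coradical" "independent B0" "span B0 = coradical"
    using subspace_basis[OF subspace_coradical] .
  let ?B = "extend_basis B0"
  have B: "independent ?B" "span ?B = UNIV" "B0 \<subseteq> ?B"
    using B0(2) independent_extend_basis span_extend_basis extend_basis_superset by auto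
  have "\<Delta> h \<in> tensors (UNIV \<times> coradical \<union> coradical \<times> UNIV)"
  proof (rule comult_in_tensorsI[OF B(1,2)])
    fix b
    let ?f = "\<lambda>x. representation ?B x b"
    have f: "?f \<in> dual" using representation_dual B by blast
    show "(b, h \<leftharpoonup> ?f) \<in> UNIV \<times> coradical \<union> coradical \<times> UNIV"
    proof (cases "b \<in> B0")
      case False
      then have "?f \<in> coradical_annihilator" unfolding coradical_annihilator_def
        using representation_outside[OF B(1,3)] B0 f by simp
      then have "h \<leftharpoonup> ?f \<in> coradical"
        using * by (intro in_coradicalI) (auto simp: dual_hit_right coradical_annihilator_def)
      then show ?thesis by simp
    qed (use B0 in auto)
  qed
  then show "h \<in> coradical_filtration 1" by simp
qed

lemma subspace_filtration_1: "subspace (coradical_filtration 1)"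
proof (rule subspaceI)
  show "0 \<in> coradical_filtration 1"
    unfolding filtration_1_iff using conv_dual dual_zero
    by (auto simp: coradical_annihilator_def)
next
  fix x y c assume x: "x \<in> coradical_filtration 1" and y: "y \<in> coradical_filtration 1"
  have L: "Vector_Spaces.linear scale (*) (conv f g)"
    if "f \<in> coradical_annihilator" "g \<in> coradical_annihilator" for f g
    using that conv_dual by (auto simp: coradical_annihilator_def dual_def)
  show "x + y \<in> coradical_filtration 1" "scale c x \<in> coradical_filtration 1"
    using x y L unfolding filtration_1_iff by (auto simp: Vector_Spaces.linear_iff)
qed

text \<open>The annihilator is an ideal and absorbs the extra functional:
  \<open>conv g k (f \<rightharpoonup> h) = conv g (conv k f) h\<close>, and similarly on the other
  side.\<close>

lemma filtration_1_hit:
  assumes "f \<in> dual" "h \<in> coradical_filtration 1"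
  shows "f \<rightharpoonup> h \<in> coradical_filtration 1" "h \<leftharpoonup> f \<in> coradical_filtration 1"
proof -
  have *: "conv g k (f \<rightharpoonup> h) = 0" "conv g k (h \<leftharpoonup> f) = 0"
    if gk: "g \<in> coradical_annihilator" "k \<in> coradical_annihilator" for g k
  proof -
    have d: "g \<in> dual" "k \<in> dual" using gk by (auto simp: coradical_annihilator_def)
    have "conv g (conv k f) h = 0" "conv (conv f g) k h = 0"
      using assms(2) gk coradical_annihilator_conv[OF _ assms(1)] unfolding filtration_1_iff by blast+
    then show "conv g k (f \<rightharpoonup> h) = 0" "conv g k (h \<leftharpoonup> f) = 0"
      using conv_assoc[OF d assms(1)] conv_assoc[OF assms(1) d]
        dual_hit[OF conv_dual[OF d]] dual_hit_right[OF conv_dual[OF d]] by metis+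
  qed
  then show "f \<rightharpoonup> h \<in> coradical_filtration 1" "h \<leftharpoonup> f \<in> coradical_filtration 1"
    unfolding filtration_1_iff by blast+
qed

lemma coradical_subset_filtration_1: "coradical \<subseteq> coradical_filtration 1"
proof
  fix x assume "x \<in> coradical"
  then have "\<Delta> x \<in> tensors (coradical \<times> coradical)"
    using subcoalgebra_coradical by (simp add: subcoalgebra_def)
  then have "\<Delta> x \<in> tensors (UNIV \<times> coradical \<union> coradical \<times> UNIV)"
    by (rule tensors_mono[rotated]) blast
  then show "x \<in> coradical_filtration 1" by simp
qed

text \<open>Bases of the coradical, of \<open>H1\<close> and of \<open>H\<close> are nested.
  Coefficients vanish outside \<open>B1\<close>, lie in the coradical outside \<open>B0\<close>, and
  always lie in \<open>H1\<close>. This makes \<open>H1\<close> modulo the coradical a bicomodule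
  over the coradical.\<close>

lemma comult_filtration_1:
  assumes h: "h \<in> coradical_filtration 1"
  shows "\<Delta> h \<in> tensors (coradical_filtration 1 \<times> coradical \<union> coradical \<times> coradical_filtration 1)"
proof -
  define H1 where "H1 = coradical_filtration 1"
  have subH1: "subspace H1" "coradical \<subseteq> H1" and h1: "h \<in> H1"
    using subspace_filtration_1 coradical_subset_filtration_1 h by (simp_all only: H1_def)
  have hit: "f \<rightharpoonup> h \<in> H1" "h \<leftharpoonup> f \<in> H1" if "f \<in> dual" for f
    using filtration_1_hit[OF that h] by (simp_all only: H1_def)
  obtain B0 where B0: "B0 \<subseteq> coradical" "independent B0" "span B0 = coradical"
    using subspace_basis[OF subspace_coradical] .
  have B01: "B0 \<subseteq> H1" using B0(1) subH1(2) by (rule subset_trans)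
  obtain B1 where B1: "B0 \<subseteq> B1" "B1 \<subseteq> H1" "independent B1" "H1 \<subseteq> span B1"
    by (rule maximal_independent_subset_extend[OF B01 B0(2)])
  have sB1: "span B1 = H1" 
    by (intro subset_antisym span_minimal B1 subH1)
  let ?B = "extend_basis B1"
  have B: "independent ?B" "span ?B = UNIV" "B1 \<subseteq> ?B"
    using B1(3) independent_extend_basis span_extend_basis extend_basis_superset by auto
  have B0': "B0 \<subseteq> ?B" using B B1(1) by blast
  show ?thesis unfolding H1_def[symmetric]
  proof (rule comult_in_tensorsI[OF B(1,2)])
    fix b assume ne: "h \<leftharpoonup> (\<lambda>x. representation ?B x b) \<noteq> 0"
    let ?f = "\<lambda>x. representation ?B x b"
    have f: "?f \<in> dual" using representation_dual B by blast
    have "b \<in> B1"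
    proof (rule ccontr)
      assume "b \<notin> B1"
      then have "?f d = 0" if "d \<in> H1" for d
        using representation_outside[OF B(1,3)] sB1 that by simp
      then have "g (h \<leftharpoonup> ?f) = g 0" if "g \<in> dual" for g
        using that hit(1)[OF that] dual_hit_right[OF that] dual_hit[OF f] dual_zero
        by metis
      with dual_eqI ne show False by blast
    qed
    show "(b, h \<leftharpoonup> ?f) \<in> H1 \<times> coradical \<union> coradical \<times> H1"
    proof (cases "b \<in> B0")
      case True
      then show ?thesis using B0(1) hit(2)[OF f] by blast
    next
      case False
      have "?f \<in> coradical_annihilator" unfolding coradical_annihilator_def
        using representation_outside[OF B(1) B0' _ False] B0(3) f by simp
      then have "h \<leftharpoonup> ?f \<in> coradical"
        using h[unfolded filtration_1_iff]
        by (intro in_coradicalI) (auto simp: dual_hit_right coradical_annihilator_def)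
      then show ?thesis using \<open>b \<in> B1\<close> B1(2) by blast
    qed
  qed
qed

end

section \<open>Non-cosemisimple coalgebras\<close>

lemma vector_space_functions: "vector_space (\<lambda>(c::'a::field) (f :: 'b \<Rightarrow> 'a) x. c * f x)"
  by unfold_locales (auto simp: algebra_simps)

context coalgebra
begin

text \<open>A linear section of \<open>a \<mapsto> a \<rightharpoonup> y\<close> on
  \<open>dual\<close> is followed by evaluation at \<open>x\<close>. Its value at
  \<open>a \<rightharpoonup> y\<close> differs from \<open>a\<close> by a functional that acts as 0
  on \<open>y\<close> and so, by hypothesis, vanishes at \<open>x\<close>.\<close>

lemma factor_functional:
  assumes "\<And>a. a \<in> dual \<Longrightarrow> a \<rightharpoonup> y = 0 \<Longrightarrow> a x = 0"
  obtains \<zeta> where "\<zeta> \<in> dual" "\<And>a. a \<in> dual \<Longrightarrow> \<zeta> (a \<rightharpoonup> y) = a x"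
proof -
  let ?s = "\<lambda>(c::'a) (f :: 'b \<Rightarrow> 'a) x. c * f x"
  interpret f: vector_space ?s by (rule vector_space_functions)
  interpret p: vector_space_pair ?s scale by unfold_locales
  have G: "Vector_Spaces.linear ?s scale (\<lambda>a. a \<rightharpoonup> y)"
  proof -
    have "(\<Sum>(c, d)\<leftarrow>ps. scale (f d + g d) c) = (\<Sum>(c, d)\<leftarrow>ps. scale (f d) c) + (\<Sum>(c, d)\<leftarrow>ps. scale (g d) c)"
      "(\<Sum>(c, d)\<leftarrow>ps. scale (k * f d) c) = scale k (\<Sum>(c, d)\<leftarrow>ps. scale (f d) c)"
      for f g :: "'b \<Rightarrow> 'a" and k ps
      by (induction ps) (auto simp: scale_left_distrib scale_right_distrib algebra_simps)
    then show ?thesis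
      by (simp add: Vector_Spaces.linear_iff hit_def vector_space_axioms f.vector_space_axioms)
  qed
  have A: "f.subspace dual"
    by (rule f.subspaceI)
      (auto simp: dual_def Vector_Spaces.linear_iff vector_space_axioms vector_space_field algebra_simps)
  obtain g where g: "range g \<subseteq> dual" "Vector_Spaces.linear scale ?s g"
    "\<And>v. v \<in> (\<lambda>a. a \<rightharpoonup> y) ` dual \<Longrightarrow> g v \<rightharpoonup> y = v"
    using p.linear_exists_right_inverse_on[OF G A] by blast
  interpret G: Vector_Spaces.linear ?s scale "\<lambda>a. a \<rightharpoonup> y" by (rule G)
  let ?z = "\<lambda>v. g v x"
  have "?z \<in> dual" using g(2)
    by (simp add: dual_def Vector_Spaces.linear_iff vector_space_axioms vector_space_field)
  moreover have "?z (a \<rightharpoonup> y) = a x" if a: "a \<in> dual" for a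
  proof -
    have "g (a \<rightharpoonup> y) - a \<in> dual" using g(1) a f.subspace_diff[OF A] by blast
    moreover have "(g (a \<rightharpoonup> y) - a) \<rightharpoonup> y = 0" using g(3) a by (simp add: G.diff)
    ultimately have "(g (a \<rightharpoonup> y) - a) x = 0" using assms by blast
    then show ?thesis by simp
  qed
  ultimately show ?thesis using that by blast
qed

text \<open>An element generating a simple left \<open>H\<^sup>*\<close>-module spans, under the right action, a simple
  subcoalgebra: a shortest sum \<open>\<Sum> x\<^sub>i \<leftharpoonup> g\<^sub>i\<close> in a non-zero subcoalgebra generates a copy of that
  module, and the isomorphism is again given by the right action.\<close>

lemma simple_generator_in_coradical:
  assumes simple: "\<And>a. a \<in> dual \<Longrightarrow> a \<rightharpoonup> x \<noteq> 0 \<Longrightarrow> \<exists>b\<in>dual. b \<rightharpoonup> (a \<rightharpoonup> x) = x"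
  shows "x \<in> coradical"
proof (cases "x = 0")
  case True then show ?thesis using subspace_0[OF subspace_coradical] by simp
next
  case False
  define X where "X = {a \<rightharpoonup> x | a. a \<in> dual}"
  have xX: "x \<in> X" unfolding X_def
    by (intro CollectI exI[of _ \<epsilon>]) (simp add: hit_counit counit_dual)
  have X_hit: "a \<rightharpoonup> z \<in> X" if "a \<in> dual" "z \<in> X" for a z
    using that hit_hit conv_dual by (auto simp: X_def)
  have X_simple: "\<exists>b\<in>dual. b \<rightharpoonup> z = x" if "z \<in> X" "z \<noteq> 0" for z
    using that simple by (auto simp: X_def)
  \<comment> \<open>The sums \<open>comb ps\<close> make up \<open>C\<close>, the sub-bimodule
    generated by \<open>x\<close>. Lists are used because the number of summands is minimised
    below.\<close>
  define comb where "comb ps = (\<Sum>(z, g)\<leftarrow>ps. z \<leftharpoonup> g)" for ps :: "('b \<times> ('b \<Rightarrow> 'a)) list"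
  define C where "C = {comb ps | ps. set ps \<subseteq> X \<times> dual}"
  have comb_hit: "a \<rightharpoonup> comb ps = comb [(a \<rightharpoonup> z, g). (z, g) \<leftarrow> ps]" if "a \<in> dual" "set ps \<subseteq> X \<times> dual" for a ps
  proof -
    interpret L: Vector_Spaces.linear scale scale "\<lambda>h. a \<rightharpoonup> h" by (rule linear_hit[OF that(1)])
    show ?thesis using that(2)
      by (induction ps) (auto simp: comb_def L.zero L.add hit_hit_right that(1))
  qed
  have comb_hit_right: "comb ps \<leftharpoonup> a = comb [(z, conv g a). (z, g) \<leftarrow> ps]" if "a \<in> dual" "set ps \<subseteq> X \<times> dual" for a ps
  proof -
    interpret L: Vector_Spaces.linear scale scale "\<lambda>h. h \<leftharpoonup> a" by (rule linear_hit_right[OF that(1)])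
    show ?thesis using that(2)
      by (induction ps) (auto simp: comb_def L.zero L.add hit_right_hit_right that(1))
  qed
  have C_hit: "a \<rightharpoonup> c \<in> C" "c \<leftharpoonup> a \<in> C" if a: "a \<in> dual" and c: "c \<in> C" for a c
  proof -
    obtain ps where ps: "c = comb ps" "set ps \<subseteq> X \<times> dual" using c by (auto simp: C_def)
    have "set [(a \<rightharpoonup> z, g). (z, g) \<leftarrow> ps] \<subseteq> X \<times> dual" "set [(z, conv g a). (z, g) \<leftarrow> ps] \<subseteq> X \<times> dual"
      using ps(2) a X_hit conv_dual by auto
    then show "a \<rightharpoonup> c \<in> C" "c \<leftharpoonup> a \<in> C"
      unfolding ps(1) C_def using comb_hit[OF a ps(2)] comb_hit_right[OF a ps(2)] by blast+
  qed
  have C_sub: "subspace C"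
  proof (rule subspaceI)
    show "0 \<in> C" unfolding C_def by (rule CollectI, rule exI[of _ "[]"]) (simp add: comb_def)
    show "c + d \<in> C" if "c \<in> C" "d \<in> C" for c d
    proof -
      from that obtain ps qs where "c = comb ps" "d = comb qs" "set (ps @ qs) \<subseteq> X \<times> dual"
        by (auto simp: C_def)
      then show ?thesis unfolding C_def by (auto simp: comb_def intro!: exI[of _ "ps @ qs"])
    qed
    show "scale k c \<in> C" if c: "c \<in> C" for k c
    proof -
      have L: "(\<lambda>h. k * \<epsilon> h) \<in> dual"
        using counit_linear unfolding dual_def by (auto intro: linear_times_right)
      have "(\<lambda>h. k * \<epsilon> h) \<rightharpoonup> c = scale k (\<epsilon> \<rightharpoonup> c)"
        unfolding hit_sw scale_sw by simp
      then show ?thesis using C_hit(1)[OF L c] by (simp add: hit_counit)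
    qed
  qed
  have xC: "x \<in> C"
    unfolding C_def
    by (rule CollectI, rule exI[of _ "[(x, \<epsilon>)]"]) (simp add: comb_def hit_right_counit xX counit_dual)
  have "C \<in> simple_subcoalgebras"
    unfolding simple_subcoalgebras_def mem_Collect_eq
  proof (intro conjI allI impI)
    show "subcoalgebra C" by (rule subcoalgebraI[OF C_sub]) (use C_hit in auto)
    show "C \<noteq> {0}" using xC False by auto
    fix E assume E: "subcoalgebra E \<and> E \<subseteq> C"
    show "E = {0} \<or> E = C"
    proof (rule disjCI)
      assume ne: "E \<noteq> C"
      show "E = {0}"
      proof (rule ccontr)
        assume "E \<noteq> {0}"
        have E0: "0 \<in> E" using E subspace_0 by (auto simp: subcoalgebra_def)
        with \<open>E \<noteq> {0}\<close> obtain y0 where "y0 \<in> E" "y0 \<noteq> 0" by blast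
        with E obtain ps0 where "set ps0 \<subseteq> X \<times> dual" "comb ps0 \<in> E" "comb ps0 \<noteq> 0"
          by (auto simp: C_def)
        then obtain ps where ps: "set ps \<subseteq> X \<times> dual" "comb ps \<in> E" "comb ps \<noteq> 0"
          and min: "\<And>qs. set qs \<subseteq> X \<times> dual \<Longrightarrow> comb qs \<in> E \<Longrightarrow> comb qs \<noteq> 0 \<Longrightarrow> length ps \<le> length qs"
          using ex_has_least_nat[of "\<lambda>ps. set ps \<subseteq> X \<times> dual \<and> comb ps \<in> E \<and> comb ps \<noteq> 0" ps0 length] by blast
        obtain z g qs where pq: "ps = (z, g) # qs" using ps(3) by (cases ps) (auto simp: comb_def)
        have zX: "z \<in> X" and g: "g \<in> dual" and qs: "set qs \<subseteq> X \<times> dual" using ps(1) pq by auto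
        define y where "y = comb ps"
        have yE: "y \<in> E" "y \<noteq> 0" using ps by (auto simp: y_def)
        have hit_y: "a \<rightharpoonup> y = (a \<rightharpoonup> z) \<leftharpoonup> g + comb [(a \<rightharpoonup> z, g). (z, g) \<leftarrow> qs]" if "a \<in> dual" for a
          unfolding y_def using comb_hit[OF that ps(1)] by (simp add: pq comb_def)
        \<comment> \<open>If \<open>a\<close> kills \<open>z\<close>, the leading summand disappears
          and \<open>a \<rightharpoonup> y\<close> is a sum shorter than the minimal one.\<close>
        have ann: "a \<rightharpoonup> y = 0" if a: "a \<in> dual" "a \<rightharpoonup> z = 0" for a
        proof (rule ccontr)
          assume "a \<rightharpoonup> y \<noteq> 0"
          moreover have "0 \<leftharpoonup> g = 0" using linear_fun_zero[OF linear_hit_right[OF g]] .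
          ultimately have "length ps \<le> length [(a \<rightharpoonup> z, g). (z, g) \<leftarrow> qs]"
            using hit_y[OF a(1)] a subcoalgebra_hit[of E a y] E yE X_hit[OF a(1)] qs
            by (intro min) auto
          then show False using pq by simp
        qed
        have z0: "z \<noteq> 0"
          using ann[OF counit_dual] yE by (auto simp: hit_counit)
        then obtain b where b: "b \<in> dual" "b \<rightharpoonup> z = x" using X_simple[OF zX] by blast
        \<comment> \<open>Conversely, if \<open>a\<close> kills \<open>y\<close> but not
          \<open>z\<close>, simplicity yields \<open>k\<close> fixing \<open>z\<close> and killing
          \<open>y\<close>; then \<open>\<epsilon> - k\<close> kills \<open>z\<close> but not
          \<open>y\<close>, against \<open>ann\<close>.\<close>
        have ann': "a \<rightharpoonup> z = 0" if a: "a \<in> dual" "a \<rightharpoonup> y = 0" for a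
        proof (rule ccontr)
          assume nz: "a \<rightharpoonup> z \<noteq> 0"
          then obtain c where c: "c \<in> dual" "c \<rightharpoonup> (a \<rightharpoonup> z) = x" using X_simple X_hit[OF a(1) zX] by blast
          obtain d where d: "d \<in> dual" "z = d \<rightharpoonup> x" using zX by (auto simp: X_def)
          define k where "k = conv (conv d c) a"
          have k: "k \<in> dual" "k \<rightharpoonup> z = z" "k \<rightharpoonup> y = 0"
            using a c d linear_fun_zero[OF linear_hit[of "conv d c"]]
            by (simp_all add: k_def conv_dual hit_hit[symmetric])
          have m: "(\<lambda>h. \<epsilon> h - k h) \<in> dual"
            using k(1) counit_dual by (auto simp: dual_def Vector_Spaces.linear_iff algebra_simps)
          have m': "(\<lambda>h. \<epsilon> h - k h) \<rightharpoonup> v = v - k \<rightharpoonup> v" for v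
            using list_sum_diff[where ps = "sweedler (\<Delta> v)" and \<beta> = "\<lambda>a b. scale (\<epsilon> b) a" and \<beta>' = "\<lambda>a b. scale (k b) a"]
              hit_counit[of v] by (simp add: hit_def scale_left_diff_distrib)
          from ann[OF m] show False using k yE by (simp add: m')
        qed
        have az: "a z = 0" if "a \<in> dual" "a \<rightharpoonup> y = 0" for a
        proof -
          have "\<epsilon> (a \<rightharpoonup> z) = 0" using ann'[OF that] dual_zero[OF counit_dual] by simp
          then show ?thesis using that(1) by (simp add: dual_hit counit_dual conv_counit_left)
        qed
        \<comment> \<open>The module isomorphism taking \<open>y\<close> to \<open>z\<close> is the
          right action of \<open>\<zeta>\<close>, as \<open>a (y \<leftharpoonup> \<zeta>) = \<zeta>
          (a \<rightharpoonup> y) = a z\<close> for every \<open>a\<close>.\<close>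
        obtain \<zeta> where \<zeta>: "\<zeta> \<in> dual" "\<And>a. a \<in> dual \<Longrightarrow> \<zeta> (a \<rightharpoonup> y) = a z"
          using factor_functional[of y z] az by blast
        have "y \<leftharpoonup> \<zeta> = z"
          by (rule dual_eqI) (use \<zeta> in \<open>simp add: dual_hit_right dual_hit\<close>)
        then have "z \<in> E" using subcoalgebra_hit_right[of E \<zeta> y] E \<zeta> yE by auto
        then have "x \<in> E" using subcoalgebra_hit[of E b z] E b by auto
        then have "X \<subseteq> E" using subcoalgebra_hit[of E] E by (auto simp: X_def)
        then have "comb qs \<in> E" if "set qs \<subseteq> X \<times> dual" for qs
          using that E0 E subcoalgebra_hit_right[of E] 
          by (induction qs) (auto simp: comb_def subcoalgebra_def intro!: subspace_add)
        then have "C \<subseteq> E" by (auto simp: C_def)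
        with ne E show False by blast
      qed
    qed
  qed
  then show ?thesis unfolding coradical_def using xC span_base by blast
qed

text \<open>Among the \<open>w\<close> outside the coradical, one with \<open>M w\<close> of least
  dimension generates a simple module modulo the coradical. The right action of an annihilator
  element kills the coradical, hence sends \<open>w\<close> to 0 or to a generator of a simple
  module, in either case into the coradical.\<close>

lemma filtration_1_not_subset_coradical:
  assumes "finite_dimensional coradical" "\<not> cosemisimple"
  shows "\<not> coradical_filtration 1 \<subseteq> coradical"
proof -
  obtain F0 where F0: "finite F0" "span F0 = coradical" using assms(1) by (auto simp: finite_dimensional_def)
  define M where "M w = {x + a \<rightharpoonup> w | x a. x \<in> coradical \<and> a \<in> dual}" for w
  have L: "Vector_Spaces.linear scale scale (\<lambda>h. a \<rightharpoonup> h)" if "a \<in> dual" for a using linear_hit[OF that] .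
  \<comment> \<open>Local finiteness: every \<open>a \<rightharpoonup> w\<close> is a combination of
    the left factors of one fixed decomposition of \<open>\<Delta> w\<close>.\<close>
  define F where "F w = F0 \<union> fst ` set (sweedler (\<Delta> w))" for w
  have fin: "finite (F w)" for w using F0 by (simp add: F_def)
  have hit_F: "a \<rightharpoonup> w \<in> span (F w)" for a w
    unfolding hit_def
  proof (rule list_sum_in_subspace)
    fix c d assume "(c, d) \<in> set (sweedler (\<Delta> w))"
    then have "c \<in> F w" unfolding F_def by force
    then show "scale (a d) c \<in> span (F w)" by (intro span_scale span_base)
  qed simp
  have MF: "M w \<subseteq> span (F w)" for w
  proof -
    have "coradical \<subseteq> span (F w)" unfolding F0(2)[symmetric] by (rule span_mono) (simp add: F_def)
    then show ?thesis using hit_F by (auto simp: M_def intro!: span_add)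
  qed
  have hit_sum: "(\<lambda>h. a h + b h) \<rightharpoonup> w = a \<rightharpoonup> w + b \<rightharpoonup> w" for a b w
    using list_sum_diff[where ps = "sweedler (\<Delta> w)" and \<beta> = "\<lambda>c d. scale (a d + b d) c" and \<beta>' = "\<lambda>c d. scale (b d) c"]
    by (simp add: hit_def scale_left_distrib algebra_simps)
  have hit_scl: "(\<lambda>h. k * a h) \<rightharpoonup> w = scale k (a \<rightharpoonup> w)" for a k w
    unfolding hit_sw scale_sw by simp
  have dual_add: "(\<lambda>h. a h + b h) \<in> dual" "(\<lambda>h. k * a h) \<in> dual" if "a \<in> dual" "b \<in> dual" for a b k
    using that by (auto simp: dual_def Vector_Spaces.linear_iff algebra_simps)
  have Msub: "subspace (M w)" for w
  proof (rule subspaceI)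
    have "0 \<rightharpoonup> w = 0" using hit_scl[of 0 \<epsilon> w] by (simp add: zero_fun_def)
    moreover have "0 \<in> dual" using dual_add(2)[OF counit_dual counit_dual, of 0] by (simp add: zero_fun_def)
    ultimately show "0 \<in> M w" unfolding M_def using subspace_0[OF subspace_coradical] 
      by (metis (mono_tags, lifting) CollectI add.right_neutral)
    fix u v k assume "u \<in> M w" "v \<in> M w"
    then obtain x a y b where u: "u = x + a \<rightharpoonup> w" "x \<in> coradical" "a \<in> dual"
      and v: "v = y + b \<rightharpoonup> w" "y \<in> coradical" "b \<in> dual" by (auto simp: M_def)
    have "u + v = (x + y) + (\<lambda>h. a h + b h) \<rightharpoonup> w" by (simp add: u v hit_sum algebra_simps)
    then show "u + v \<in> M w" unfolding M_def
      using u v dual_add(1) subspace_add[OF subspace_coradical] by blast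
    have "scale k u = scale k x + (\<lambda>h. k * a h) \<rightharpoonup> w" by (simp add: u hit_scl scale_right_distrib)
    then show "scale k u \<in> M w" unfolding M_def
      using u dual_add(2) subspace_scale[OF subspace_coradical] by blast
  qed
  have wM: "w \<in> M w" for w
    unfolding M_def using hit_counit counit_dual subspace_0[OF subspace_coradical]
    by (metis (mono_tags, lifting) CollectI add.left_neutral)
  have Mmono: "M v \<subseteq> M w" if v: "v \<in> M w" for v w
  proof
    fix u assume "u \<in> M v"
    then obtain x a where u: "u = x + a \<rightharpoonup> v" "x \<in> coradical" "a \<in> dual" by (auto simp: M_def)
    obtain y b where v: "v = y + b \<rightharpoonup> w" "y \<in> coradical" "b \<in> dual" using v by (auto simp: M_def)
    have "u = (x + a \<rightharpoonup> y) + conv a b \<rightharpoonup> w"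
      using L[OF u(3)] by (simp add: u v Vector_Spaces.linear_iff hit_hit algebra_simps)
    then show "u \<in> M w" unfolding M_def
      using u v conv_dual subspace_add[OF subspace_coradical] subcoalgebra_hit[OF subcoalgebra_coradical] by blast
  qed
  obtain w0 where "w0 \<notin> coradical" using assms(2) by (auto simp: cosemisimple_def)
  then obtain w where w: "w \<notin> coradical" and min: "\<And>v. v \<notin> coradical \<Longrightarrow> dim (M w) \<le> dim (M v)"
    using ex_has_least_nat[of "\<lambda>w. w \<notin> coradical" w0 "\<lambda>w. dim (M w)"] by blast
  have M_back: "w \<in> M v" if v: "v \<in> M w" "v \<notin> coradical" for v
  proof (rule ccontr)
    assume "w \<notin> M v"
    then have "M v \<subset> M w" using Mmono[OF v(1)] wM by blast
    from dim_strict_mono_finite[OF fin this Msub Msub MF] min[OF v(2)] show False by simp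
  qed
  have "w \<leftharpoonup> g \<in> coradical" if g: "g \<in> coradical_annihilator" for g
  proof (rule simple_generator_in_coradical)
    fix a assume a: "a \<in> dual" "a \<rightharpoonup> (w \<leftharpoonup> g) \<noteq> 0"
    have gd: "g \<in> dual" using g by (simp add: coradical_annihilator_def)
    have kill: "x \<leftharpoonup> g = 0" if x: "x \<in> coradical" for x
    proof (rule dual_eqI)
      fix f assume f: "f \<in> dual"
      show "f (x \<leftharpoonup> g) = f 0"
        using coradical_annihilator_conv(1)[OF g f] x
        by (simp add: dual_hit_right f dual_zero coradical_annihilator_def)
    qed
    interpret R: Vector_Spaces.linear scale scale "\<lambda>h. h \<leftharpoonup> g" by (rule linear_hit_right[OF gd])
    let ?v = "a \<rightharpoonup> w"
    have "?v \<notin> coradical" using a kill by (auto simp: hit_hit_right gd)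
    moreover have "?v \<in> M w" unfolding M_def using a subspace_0[OF subspace_coradical] 
      by (metis (mono_tags, lifting) CollectI add.left_neutral)
    ultimately obtain x b where xb: "w = x + b \<rightharpoonup> ?v" "x \<in> coradical" "b \<in> dual"
      using M_back[of ?v] by (auto simp: M_def)
    have "w \<leftharpoonup> g = (b \<rightharpoonup> ?v) \<leftharpoonup> g" by (subst xb(1)) (simp add: R.add kill[OF xb(2)])
    then have "b \<rightharpoonup> (a \<rightharpoonup> (w \<leftharpoonup> g)) = w \<leftharpoonup> g"
      using hit_hit_right[OF a(1) gd] hit_hit_right[OF xb(3) gd] by metis
    then show "\<exists>b\<in>dual. b \<rightharpoonup> (a \<rightharpoonup> (w \<leftharpoonup> g)) = w \<leftharpoonup> g" using xb by blast
  qed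
  \<comment> \<open>\<open>conv g f w = f (w \<leftharpoonup> g)\<close>, and \<open>f\<close>
    vanishes on the coradical.\<close>
  then have "w \<in> coradical_filtration 1" unfolding filtration_1_iff
    by (auto simp: coradical_annihilator_def dual_hit_right[symmetric])
  with w show ?thesis by blast
qed

end

section \<open>Hopf powers and the antipode\<close>

context hopf_algebra
begin

lemma linear_mult_left:
  "Vector_Spaces.linear scale scale f \<Longrightarrow> Vector_Spaces.linear scale scale (\<lambda>x. f x * y)"
  by (simp add: Vector_Spaces.linear_iff algebra_simps mult_scale_left)

lemma linear_mult_right:
  "Vector_Spaces.linear scale scale f \<Longrightarrow> Vector_Spaces.linear scale scale (\<lambda>x. y * f x)"
  by (simp add: Vector_Spaces.linear_iff algebra_simps mult_scale_right)

lemmas hopf_linear_rules = linear_rules linear_mult_left linear_mult_right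
  linear_comp[OF antipode_linear] linear_comp[OF counit_linear]

lemma mult_sw: "(y::'b) * sw \<beta> h = sw (\<lambda>a b. y * \<beta> a b) h"
  by (rule linear_of_sw[OF linear_mult_right[OF linear_ident]])

lemma sw_mult: "sw \<beta> h * (y::'b) = sw (\<lambda>a b. \<beta> a b * y) h"
  by (rule linear_of_sw[OF linear_mult_left[OF linear_ident]])

lemma sw_of_mult:
  assumes "bilin s \<beta>"
  shows "sw \<beta> (x * y) = sw (\<lambda>a b. sw (\<lambda>c d. \<beta> (a * c) (b * d)) y) x"
proof -
  have "(\<Sum>(a, b)\<leftarrow>[(a * c, b * d). (a, b) \<leftarrow> ps, (c, d) \<leftarrow> qs]. \<beta> a b) =
    (\<Sum>(a, b)\<leftarrow>ps. \<Sum>(c, d)\<leftarrow>qs. \<beta> (a * c) (b * d))" for ps qs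
    by (induction ps) (auto simp: comp_def split_def)
  then show ?thesis by (subst sw_eq[OF assms comult_mult]) (simp add: sw_def)
qed

lemma sw_antipode_left: "sw (\<lambda>a b. S a * b) h = scale (\<epsilon> h) 1"
  using antipode_left[of h] by (simp add: sw_def)

lemma sw_antipode_right: "sw (\<lambda>a b. a * S b) h = scale (\<epsilon> h) 1"
  using antipode_right[of h] by (simp add: sw_def)

text \<open>\<open>W\<close> has convolution product \<open>\<epsilon> z\<close> with the identity;
  convolving with \<open>S\<close> on the right isolates \<open>W\<close>. A general constant
  \<open>z\<close> allows the nested use in \<open>antipode_mult\<close>.\<close>

lemma antipode_unique:
  assumes W: "Vector_Spaces.linear scale scale W"
    and eq: "\<And>y. sw (\<lambda>a b. W a * b) y = scale (\<epsilon> y) z"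
  shows "W y = z * S y"
proof -
  note r = hopf_linear_rules linear_comp[OF W] W
  have "W y = sw (\<lambda>a b. scale (\<epsilon> b) (W a)) y" by (rule sw_counit_right[OF W, symmetric])
  also have "\<dots> = sw (\<lambda>a b. sw (\<lambda>b1 b2. W a * (b1 * S b2)) b) y"
    by (simp add: mult_sw[symmetric] sw_antipode_right mult_scale_right)
  also have "\<dots> = sw (\<lambda>a b. sw (\<lambda>a1 a2. W a1 * (a2 * S b)) a) y"
    by (rule sw_coassoc[symmetric, where s = scale]) (rule r)+
  also have "\<dots> = sw (\<lambda>a b. scale (\<epsilon> a) (z * S b)) y"
    by (simp add: mult.assoc[symmetric] sw_mult[symmetric] eq mult_scale_left)
  also have "\<dots> = z * S y"
    by (rule sw_counit_left) (rule r)+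
  finally show ?thesis .
qed

text \<open>Uniqueness is used twice: in \<open>x\<close> with the constant \<open>S y\<close>, and,
  to verify the hypothesis of that use, in \<open>y\<close> with the constant
  \<open>\<epsilon> x\<close>, where the antipode axiom for \<open>x * y\<close> applies.\<close>

lemma antipode_mult: "S (x * y) = S y * S x"
proof (rule antipode_unique)
  show "Vector_Spaces.linear scale scale (\<lambda>x. S (x * y))" by (rule hopf_linear_rules)+
  fix x
  have "sw (\<lambda>a b. S (a * y) * b) x = scale (\<epsilon> x) 1 * S y"
  proof (rule antipode_unique[where W = "\<lambda>y. sw (\<lambda>a b. S (a * y) * b) x"])
    show "Vector_Spaces.linear scale scale (\<lambda>y. sw (\<lambda>a b. S (a * y) * b) x)"
      by (rule hopf_linear_rules)+
    fix y
    have "sw (\<lambda>c d. sw (\<lambda>a b. S (a * c) * b) x * d) y = sw (\<lambda>c d. sw (\<lambda>a b. S (a * c) * (b * d)) x) y"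
      unfolding sw_mult mult.assoc ..
    also have "\<dots> = sw (\<lambda>a b. sw (\<lambda>c d. S (a * c) * (b * d)) y) x"
      by (rule sw_swap)
    also have "\<dots> = sw (\<lambda>a b. S a * b) (x * y)"
      by (rule sw_of_mult[symmetric, where s = scale]) (rule hopf_linear_rules)+
    finally show "sw (\<lambda>c d. sw (\<lambda>a b. S (a * c) * b) x * d) y = scale (\<epsilon> y) (scale (\<epsilon> x) 1)"
      by (simp add: sw_antipode_left counit_mult mult.commute)
  qed
  then show "sw (\<lambda>a b. S (a * y) * b) x = scale (\<epsilon> x) (S y)" by (simp add: mult_scale_left)
qed

section \<open>Recursion for Hopf powers\<close>

lemma hopf_power_1: "hopf_power h 1 = h"
  by (simp add: hopf_power_def)

text \<open>The outermost application of \<open>\<Delta>\<close> contributes the last letter of each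
  word. For positive \<open>n\<close> the subtraction in \<open>hopf_power\<close> is exact; later
  statements use \<open>Suc n\<close> to stay in this range.\<close>

lemma hopf_power_Suc:
  assumes "n \<ge> 1"
  shows "hopf_power h (Suc n) = sw (\<lambda>a b. hopf_power a n * b) h"
proof -
  obtain m where n: "n = Suc m" using assms by (cases n) auto
  have 1: "(\<Sum>w\<leftarrow>ws. prod_list (w @ [b])) = (\<Sum>w\<leftarrow>ws. prod_list w) * b" for ws and b :: 'b
    by (induction ws) (auto simp: algebra_simps)
  have "(\<Sum>w\<leftarrow>[w @ [b]. (a, b) \<leftarrow> ps, w \<leftarrow> f a]. prod_list w) =
    (\<Sum>(a, b)\<leftarrow>ps. (\<Sum>w\<leftarrow>f a. prod_list w) * b)" for ps :: "('b \<times> 'b) list" and f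
  proof (induction ps)
    case (Cons p ps)
    then show ?case using 1[of "snd p" "f (fst p)"] by (simp add: split_def comp_def)
  qed simp
  then show ?thesis by (simp add: hopf_power_def n sw_def)
qed

lemma linear_hopf_power:
  "Vector_Spaces.linear scale scale (\<lambda>h. hopf_power h (Suc n))"
proof (induction n)
  case 0
  show ?case using hopf_power_1 linear_ident by simp
next
  case (Suc n)
  have "(\<lambda>h. hopf_power h (Suc (Suc n))) = (\<lambda>h. sw (\<lambda>a b. hopf_power a (Suc n) * b) h)"
    by (simp add: hopf_power_Suc)
  then show ?case by (simp only:) (rule hopf_linear_rules linear_comp[OF Suc] Suc)+
qed

lemma counit_hopf_power: "\<epsilon> (hopf_power h (Suc n)) = \<epsilon> h"
proof (induction n arbitrary: h)
  case 0
  show ?case using hopf_power_1 by simp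
next
  case (Suc n)
  have "\<epsilon> (hopf_power h (Suc (Suc n))) = sw (\<lambda>a b. \<epsilon> a * \<epsilon> b) h"
    by (subst hopf_power_Suc) (simp_all add: linear_of_sw[OF counit_linear] counit_mult Suc)
  also have "\<dots> = \<epsilon> h" by (rule sw_counit_left[OF counit_linear])
  finally show ?case .
qed

text \<open>Coassociativity gives \<open>\<Delta> (f \<rightharpoonup> h) = \<Sum>h_1 \<otimes> (f
  \<rightharpoonup> h_2)\<close>. This lets \<open>u\<close> act on the second factor while the
  terms are still those of \<open>\<Delta> h\<close>.\<close>

lemma sw_hit:
  assumes f: "f \<in> dual" and \<beta>: "\<And>y. Vector_Spaces.linear scale scale (\<lambda>x. \<beta> x y)"
    "\<And>x. Vector_Spaces.linear scale scale (\<lambda>y. \<beta> x y)"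
  shows "sw \<beta> (f \<rightharpoonup> h) = sw (\<lambda>a b. \<beta> a (f \<rightharpoonup> b)) h"
proof -
  note r = hopf_linear_rules linear_comp[OF \<beta>(1)] linear_comp[OF \<beta>(2)] linear_dual[OF f] dual_linear[OF f] \<beta>
  have lin: "Vector_Spaces.linear scale scale (sw \<beta>)" by (rule linear_sw bilinI \<beta>)+
  have "sw \<beta> (f \<rightharpoonup> h) = sw (\<lambda>a b. sw \<beta> (scale (f b) a)) h"
    unfolding hit_sw by (rule linear_of_sw[OF lin])
  also have "\<dots> = sw (\<lambda>a b. sw (\<lambda>a1 a2. scale (f b) (\<beta> a1 a2)) a) h"
    using lin by (simp add: Vector_Spaces.linear_iff scale_sw)
  also have "\<dots> = sw (\<lambda>a b. sw (\<lambda>b1 b2. scale (f b2) (\<beta> a b1)) b) h"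
    by (rule sw_coassoc[where s = scale]) (rule r)+
  also have "\<dots> = sw (\<lambda>a b. \<beta> a (f \<rightharpoonup> b)) h"
    unfolding hit_sw using \<beta>(2) by (simp add: linear_of_sw[OF \<beta>(2)] Vector_Spaces.linear_iff)
  finally show ?thesis .
qed

end

section \<open>Computing modulo the coradical\<close>

text \<open>Collects the behaviour of the unit idempotent \<open>u\<close> on the coradical,
  together with an arbitrary linear projection onto it. \<open>proj\<close> marks the tensor factors
  in the coradical, so that coactions on \<open>H1/H0\<close> become Sweedler sums in
  \<open>H\<close> without a quotient type.\<close>

locale hopf_coradical = hopf_algebra scale \<Delta> \<epsilon> S
  for scale :: "'a::field \<Rightarrow> 'b::ring_1 \<Rightarrow> 'b"
    and \<Delta> :: "'b \<Rightarrow> ('b list \<Rightarrow>\<^sub>0 'a) set"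
    and \<epsilon> :: "'b \<Rightarrow> 'a"
    and S :: "'b \<Rightarrow> 'b" +
  fixes u :: "'b \<Rightarrow> 'a" and proj :: "'b \<Rightarrow> 'b"
  assumes hopf_subalgebra_coradical: "hopf_subalgebra coradical"
    and u_dual: "u \<in> dual"
    and u_one: "u 1 = 1"
    and hit_coradical: "x \<in> coradical \<Longrightarrow> u \<rightharpoonup> x = scale (u x) 1"
    and proj_linear: "Vector_Spaces.linear scale scale proj"
    and proj_in: "proj x \<in> coradical"
    and proj_id: "x \<in> coradical \<Longrightarrow> proj x = x"
begin

section \<open>Congruence modulo \<open>H0\<close> and the Hopf bimodule structure of
  \<open>H1/H0\<close>\<close>

abbreviation H0 :: "'b set" where "H0 \<equiv> coradical"
abbreviation H1 :: "'b set" where "H1 \<equiv> coradical_filtration 1"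

definition eqv :: "'b \<Rightarrow> 'b \<Rightarrow> bool"  (infix \<open>\<simeq>\<close> 50) where
  "x \<simeq> y \<longleftrightarrow> x - y \<in> H0"

lemma eqv_sym: "x \<simeq> y \<Longrightarrow> y \<simeq> x"
  unfolding eqv_def using subspace_neg[OF subspace_coradical, of "x - y"] by simp

lemma eqv_trans [trans]: "x \<simeq> y \<Longrightarrow> y \<simeq> z \<Longrightarrow> x \<simeq> z"
  unfolding eqv_def using subspace_add[OF subspace_coradical, of "x - y" "y - z"] by simp

lemma eqv_eq_trans [trans]: "x \<simeq> y \<Longrightarrow> y = z \<Longrightarrow> x \<simeq> z"
  and eq_eqv_trans [trans]: "x = y \<Longrightarrow> y \<simeq> z \<Longrightarrow> x \<simeq> z"
  by simp_all

lemma eqv_mem: "x \<simeq> y \<Longrightarrow> y \<in> H0 \<Longrightarrow> x \<in> H0"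
  unfolding eqv_def using subspace_add[OF subspace_coradical, of "x - y" y] by simp

lemma H0_mult: "x \<in> H0 \<Longrightarrow> y \<in> H0 \<Longrightarrow> x * y \<in> H0"
  and H0_antipode: "x \<in> H0 \<Longrightarrow> S x \<in> H0"
  and H0_one: "1 \<in> H0"
  using hopf_subalgebra_coradical by (auto simp: hopf_subalgebra_def)

lemma H0_scale: "x \<in> H0 \<Longrightarrow> scale c x \<in> H0"
  by (rule subspace_scale[OF subspace_coradical])

lemma comult_H0: "x \<in> H0 \<Longrightarrow> \<Delta> x \<in> tensors (H0 \<times> H0)"
  using subcoalgebra_coradical by (simp add: subcoalgebra_def)

lemmas H_rules = hopf_linear_rules linear_comp[OF proj_linear] linear_dual[OF u_dual] proj_linear
  dual_linear[OF u_dual]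

lemma sw_in_H0:
  assumes "\<And>a b. \<beta> a b \<in> H0"
  shows "sw \<beta> h \<in> H0"
  unfolding sw_def by (rule list_sum_in_subspace[OF subspace_coradical]) (rule assms)

text \<open>Multiplying a term of \<open>\<Delta> h\<close> by a term of \<open>\<Delta> x\<close>
  in \<open>H0 \<otimes> H0\<close> keeps one factor in the subalgebra \<open>H0\<close>, so
  products of two annihilator elements still vanish.\<close>

lemma H1_mult_H0:
  assumes "h \<in> H1" "x \<in> H0"
  shows "h * x \<in> H1"
proof -
  obtain ps where ps: "\<Delta> h = tensor2 ps" "set ps \<subseteq> UNIV \<times> H0 \<union> H0 \<times> UNIV"
    using assms(1) by (auto simp: tensors_def)
  obtain qs where qs: "\<Delta> x = tensor2 qs" "set qs \<subseteq> H0 \<times> H0"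
    using comult_H0[OF assms(2)] by (auto simp: tensors_def)
  have "conv f g (h * x) = 0" if fg: "f \<in> coradical_annihilator" "g \<in> coradical_annihilator" for f g
  proof -
    have d: "f \<in> dual" "g \<in> dual" and z: "\<And>x. x \<in> H0 \<Longrightarrow> f x = 0" "\<And>x. x \<in> H0 \<Longrightarrow> g x = 0"
      using fg by (auto simp: coradical_annihilator_def)
    note r = H_rules linear_dual[OF d(1)] linear_dual[OF d(2)] dual_linear[OF d(1)] dual_linear[OF d(2)]
    have "conv f g (h * x) = sw (\<lambda>a b. sw (\<lambda>c d. f (a * c) * g (b * d)) x) h"
      unfolding conv_sw by (rule sw_of_mult[where s = "(*)"]) (rule r)+
    also have "\<dots> = (\<Sum>(a, b)\<leftarrow>ps. sw (\<lambda>c d. f (a * c) * g (b * d)) x)"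
      by (rule sw_eq[OF _ ps(1), where s = "(*)"]) (rule r)+
    also have "\<dots> = (\<Sum>(a, b)\<leftarrow>ps. \<Sum>(c, d)\<leftarrow>qs. f (a * c) * g (b * d))"
      by (subst sw_eq[OF _ qs(1), where s = "(*)"]) (rule r refl)+
    also have "\<dots> = 0"
      using ps(2)
    proof (induction ps)
      case (Cons p ps)
      obtain a b where p: "p = (a, b)" by force
      have "(\<Sum>(c, d)\<leftarrow>qs. f (a * c) * g (b * d)) = 0"
        using qs(2)
      proof (induction qs)
        case (Cons q qs)
        obtain c d where q: "q = (c, d)" by force
        have "a * c \<in> H0 \<or> b * d \<in> H0" using H0_mult Cons.prems \<open>set (p # ps) \<subseteq> _\<close> p q by auto
        then have "f (a * c) * g (b * d) = 0" using z by auto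
        then show ?case using Cons q by simp
      qed simp
      then show ?case using Cons p by simp
    qed simp
    finally show ?thesis .
  qed
  then show ?thesis unfolding filtration_1_iff by blast
qed

text \<open>On terms with right factor in \<open>H0\<close> the projection changes nothing; on the
  others the left factor is in \<open>H0\<close> and both expressions fall into \<open>H0\<close>.
  The result is the right coaction of \<open>H0\<close> on \<open>H1/H0\<close>;
  \<open>sw_proj_left\<close> is its mirror image.\<close>

lemma sw_proj_right:
  assumes "h \<in> H1" "\<And>y. Vector_Spaces.linear scale scale (\<lambda>x. \<beta> x y)"
    "\<And>x. Vector_Spaces.linear scale scale (\<lambda>y. \<beta> x y)"
    and "\<And>a b. a \<in> H0 \<Longrightarrow> \<beta> a b \<in> H0"
  shows "sw \<beta> h \<simeq> sw (\<lambda>a b. \<beta> a (proj b)) h"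
  unfolding eqv_def
proof (rule sw_diff_in_subspace[OF comult_filtration_1[OF assms(1)] _ _ subspace_coradical])
  fix a b assume "(a, b) \<in> H1 \<times> H0 \<union> H0 \<times> H1"
  then show "\<beta> a b - \<beta> a (proj b) \<in> H0"
    using assms(4) proj_id subspace_diff[OF subspace_coradical] subspace_0[OF subspace_coradical] by auto
qed (rule bilinI assms(2,3) linear_comp[OF assms(3)] proj_linear)+

lemma sw_proj_left:
  assumes "h \<in> H1" "\<And>y. Vector_Spaces.linear scale scale (\<lambda>x. \<beta> x y)"
    "\<And>x. Vector_Spaces.linear scale scale (\<lambda>y. \<beta> x y)"
    and "\<And>a b. b \<in> H0 \<Longrightarrow> \<beta> a b \<in> H0"
  shows "sw \<beta> h \<simeq> sw (\<lambda>a b. \<beta> (proj a) b) h"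
  unfolding eqv_def
proof (rule sw_diff_in_subspace[OF comult_filtration_1[OF assms(1)] _ _ subspace_coradical])
  fix a b assume "(a, b) \<in> H1 \<times> H0 \<union> H0 \<times> H1"
  then show "\<beta> a b - \<beta> (proj a) b \<in> H0"
    using assms(4) proj_id subspace_diff[OF subspace_coradical] subspace_0[OF subspace_coradical] by auto
qed (rule bilinI assms(2,3) linear_comp[OF assms(2)] proj_linear)+

lemma sw_proj_H0:
  assumes "y \<in> H0" "\<And>y. Vector_Spaces.linear scale scale (\<lambda>x. \<beta> x y)"
    "\<And>x. Vector_Spaces.linear scale scale (\<lambda>y. \<beta> x y)"
  shows "sw \<beta> y = sw (\<lambda>a b. \<beta> (proj a) (proj b)) y"
  by (rule sw_cong_tensors[OF comult_H0[OF assms(1)], where s = scale])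
    (rule bilinI assms(2,3) linear_comp[OF assms(2)] linear_comp[OF assms(3)] proj_linear
      | simp add: proj_id)+

text \<open>Coassociativity of the right coaction on \<open>H1/H0\<close>: comultiplying the
  \<open>H0\<close> factor amounts to coacting twice.\<close>

lemma coassoc_right:
  assumes h: "h \<in> H1"
    and l1: "\<And>y z. Vector_Spaces.linear scale scale (\<lambda>x. \<gamma> x y z)"
    and l2: "\<And>x z. Vector_Spaces.linear scale scale (\<lambda>y. \<gamma> x y z)"
    and l3: "\<And>x y. Vector_Spaces.linear scale scale (\<lambda>z. \<gamma> x y z)"
    and in0: "\<And>x y z. x \<in> H0 \<Longrightarrow> y \<in> H0 \<Longrightarrow> z \<in> H0 \<Longrightarrow> \<gamma> x y z \<in> H0"
  shows "sw (\<lambda>a b. sw (\<lambda>c d. \<gamma> a c d) (proj b)) h \<simeq> sw (\<lambda>a b. sw (\<lambda>c d. \<gamma> c (proj d) (proj b)) a) h"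
proof -
  note r = H_rules linear_comp[OF l2] linear_comp[OF l3] l1
  \<comment> \<open>Inserting the projections first makes \<open>in0\<close> applicable for
    \<open>a\<close> in \<open>H0\<close> and arbitrary \<open>b\<close>, as
    \<open>sw_proj_right\<close> demands.\<close>
  have p: "sw (\<lambda>c d. \<gamma> a c d) (proj b) = sw (\<lambda>c d. \<gamma> a (proj c) (proj d)) (proj b)" for a b
    by (rule sw_proj_H0[OF proj_in]) (rule l2 l3)+
  have "sw (\<lambda>a b. sw (\<lambda>c d. \<gamma> a c d) (proj b)) h =
      sw (\<lambda>a b. sw (\<lambda>c d. \<gamma> a (proj c) (proj d)) (proj b)) h"
    by (simp only: p)
  also have "\<dots> \<simeq> sw (\<lambda>a b. sw (\<lambda>c d. \<gamma> a (proj c) (proj d)) b) h"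
  proof (rule eqv_sym, rule sw_proj_right[OF h])
    fix a b assume "a \<in> H0"
    then show "sw (\<lambda>c d. \<gamma> a (proj c) (proj d)) b \<in> H0" by (intro sw_in_H0 in0 proj_in)
  qed (rule r)+
  also have "\<dots> = sw (\<lambda>a b. sw (\<lambda>c d. \<gamma> c (proj d) (proj b)) a) h"
    by (rule sw_coassoc[symmetric, where s = scale]) (rule r)+
  finally show ?thesis .
qed

lemma coassoc_left:
  assumes h: "h \<in> H1"
    and l1: "\<And>y z. Vector_Spaces.linear scale scale (\<lambda>x. \<gamma> x y z)"
    and l2: "\<And>x z. Vector_Spaces.linear scale scale (\<lambda>y. \<gamma> x y z)"
    and l3: "\<And>x y. Vector_Spaces.linear scale scale (\<lambda>z. \<gamma> x y z)"
    and in0: "\<And>x y z. x \<in> H0 \<Longrightarrow> y \<in> H0 \<Longrightarrow> z \<in> H0 \<Longrightarrow> \<gamma> x y z \<in> H0"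
  shows "sw (\<lambda>a b. sw (\<lambda>c d. \<gamma> c d b) (proj a)) h \<simeq> sw (\<lambda>a b. sw (\<lambda>c d. \<gamma> (proj a) (proj c) d) b) h"
proof -
  note r = H_rules linear_comp[OF l1] linear_comp[OF l2] l3
  have p: "sw (\<lambda>c d. \<gamma> c d b) (proj a) = sw (\<lambda>c d. \<gamma> (proj c) (proj d) b) (proj a)" for a b
    by (rule sw_proj_H0[OF proj_in]) (rule l1 l2)+
  have "sw (\<lambda>a b. sw (\<lambda>c d. \<gamma> c d b) (proj a)) h =
      sw (\<lambda>a b. sw (\<lambda>c d. \<gamma> (proj c) (proj d) b) (proj a)) h"
    by (simp only: p)
  also have "\<dots> \<simeq> sw (\<lambda>a b. sw (\<lambda>c d. \<gamma> (proj c) (proj d) b) a) h"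
  proof (rule eqv_sym, rule sw_proj_left[OF h])
    fix a b assume "b \<in> H0"
    then show "sw (\<lambda>c d. \<gamma> (proj c) (proj d) b) a \<in> H0" by (intro sw_in_H0 in0 proj_in)
  qed (rule r)+
  also have "\<dots> = sw (\<lambda>a b. sw (\<lambda>c d. \<gamma> (proj a) (proj c) d) b) h"
    by (rule sw_coassoc[where s = scale]) (rule r)+
  finally show ?thesis .
qed

end

section \<open>Coinvariants\<close>

context hopf_coradical
begin

text \<open>Since \<open>u \<rightharpoonup> y = scale (u y) 1\<close> on \<open>H0\<close>, the
  restriction of \<open>u\<close> is a left integral of the dual of \<open>H0\<close>. Inserting
  \<open>S(c_1) c_2\<close> before \<open>x_1\<close> turns the left side into
  \<open>\<Sum>S(c_1) (u \<rightharpoonup> c_2 x)\<close>.\<close>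

lemma unit_twist_H0:
  assumes c: "c \<in> H0" and x: "x \<in> H0"
  shows "sw (\<lambda>x1 x2. scale (u (c * x2)) x1) x = sw (\<lambda>c1 c2. scale (u (c2 * x)) (S c1)) c"
proof -
  define G where "G b = sw (\<lambda>x1 x2. scale (u (b * x2)) x1) x" for b
  have G: "Vector_Spaces.linear scale scale G" unfolding G_def by (rule H_rules)+
  note r = H_rules linear_comp[OF G] G linear_hit[OF u_dual] linear_comp[OF linear_hit[OF u_dual]]
  have hit_G: "u \<rightharpoonup> (y * x) = sw (\<lambda>y1 y2. y1 * G y2) y" for y
  proof -
    have "u \<rightharpoonup> (y * x) = sw (\<lambda>y1 y2. sw (\<lambda>x1 x2. scale (u (y2 * x2)) (y1 * x1)) x) y"
      unfolding hit_sw by (rule sw_of_mult[where s = scale]) (rule r)+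
    then show ?thesis by (simp add: G_def mult_sw mult_scale_right)
  qed
  have "sw (\<lambda>c1 c2. scale (u (c2 * x)) (S c1)) c = sw (\<lambda>c1 c2. S c1 * (u \<rightharpoonup> (c2 * x))) c"
  proof (rule sw_cong_tensors[OF comult_H0[OF c], where s = scale])
    fix a b assume "(a, b) \<in> H0 \<times> H0"
    then show "scale (u (b * x)) (S a) = S a * (u \<rightharpoonup> (b * x))"
      using hit_coradical[OF H0_mult[OF _ x]] by (simp add: mult_scale_right)
  qed (rule r)+
  also have "\<dots> = sw (\<lambda>a b. sw (\<lambda>b1 b2. S a * (b1 * G b2)) b) c"
    by (simp only: hit_G mult_sw)
  also have "\<dots> = sw (\<lambda>a b. sw (\<lambda>a1 a2. S a1 * (a2 * G b)) a) c"
    by (rule sw_coassoc[symmetric, where s = scale]) (rule r)+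
  also have "\<dots> = sw (\<lambda>a b. scale (\<epsilon> a) (G b)) c"
    by (simp add: mult.assoc[symmetric] sw_mult[symmetric] sw_antipode_left mult_scale_left)
  also have "\<dots> = G c" by (rule sw_counit_left[OF G])
  finally show ?thesis by (simp add: G_def)
qed

text \<open>Right coinvariants of the Hopf module \<open>H\<^sub>1/H\<^sub>0\<close> generate it, so they cannot vanish.\<close>

lemma H1_subset_if_unit_component_trivial:
  assumes triv: "\<And>h. h \<in> H1 \<Longrightarrow> u \<rightharpoonup> h \<in> H0" and h: "h \<in> H1"
  shows "h \<in> H0"
proof -
  define K where "K x c = sw (\<lambda>c1 c2. scale (u (c2 * x)) (S c1)) c" for x c
  have K1: "Vector_Spaces.linear scale scale (\<lambda>x. K x c)"
    and K2: "Vector_Spaces.linear scale scale (\<lambda>c. K x c)" for x c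
    unfolding K_def by (rule H_rules)+
  note r = H_rules linear_comp[OF K1] linear_comp[OF K2] K1 K2
  have K_in: "K x c \<in> H0" if "c \<in> H0" for x c
    unfolding K_def
  proof (rule sw_in_subspace[OF comult_H0[OF that] _ subspace_coradical])
    show "scale (u (b * x)) (S a) \<in> H0" if "(a, b) \<in> H0 \<times> H0" for a b
      using that by (intro H0_scale H0_antipode) auto
  qed (rule r)+
  \<comment> \<open>By the twist identity the sum is congruent to
    \<open>u \<rightharpoonup> (a * x)\<close>, which lies in \<open>H0\<close> by
    \<open>triv\<close>.\<close>
  have E: "sw (\<lambda>a1 a2. a1 * K x (proj a2)) a \<in> H0" if a: "a \<in> H1" and x: "x \<in> H0" for a x
  proof -
    define G where "G b = sw (\<lambda>x1 x2. scale (u (b * x2)) x1) x" for b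
    have G: "Vector_Spaces.linear scale scale G" unfolding G_def by (rule H_rules)+
    have G_in: "G b \<in> H0" for b
      unfolding G_def
    proof (rule sw_in_subspace[OF comult_H0[OF x] _ subspace_coradical])
      show "scale (u (b * x2)) x1 \<in> H0" if "(x1, x2) \<in> H0 \<times> H0" for x1 x2
        using that by (intro H0_scale) auto
    qed (rule r)+
    have "sw (\<lambda>a1 a2. a1 * K x (proj a2)) a = sw (\<lambda>a1 a2. a1 * G (proj a2)) a"
      unfolding K_def G_def by (simp only: unit_twist_H0[OF proj_in x])
    also have "\<dots> \<simeq> sw (\<lambda>a1 a2. a1 * G a2) a"
      by (rule eqv_sym, rule sw_proj_right[OF a])
        (rule r linear_comp[OF G] G | intro H0_mult G_in, assumption)+
    also have "\<dots> = sw (\<lambda>y1 y2. sw (\<lambda>x1 x2. scale (u (y2 * x2)) (y1 * x1)) x) a"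
      by (simp only: G_def mult_sw mult_scale_right)
    also have "\<dots> = u \<rightharpoonup> (a * x)"
      unfolding hit_sw by (rule sw_of_mult[symmetric, where s = scale]) (rule r)+
    finally show ?thesis using eqv_mem triv[OF H1_mult_H0[OF a x]] by blast
  qed
  have T: "sw (\<lambda>a b. a * S (proj b)) h \<in> H0" if h: "h \<in> H1" for h
  proof -
    \<comment> \<open>\<open>\<Sum>S(y_1) u(y_2 S(y_3)) = S(y)\<close> because
      \<open>u 1 = 1\<close>; rewriting the antipode in this way makes \<open>E\<close>
      applicable.\<close>
    have K_S: "sw (\<lambda>c d. K (S d) c) y = S y" for y
    proof -
      have "sw (\<lambda>c d. K (S d) c) y = sw (\<lambda>a b. sw (\<lambda>b1 b2. scale (u (b1 * S b2)) (S a)) b) y"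
        unfolding K_def by (rule sw_coassoc[where s = scale]) (rule r)+
      also have "\<dots> = sw (\<lambda>a b. scale (\<epsilon> b) (S a)) y"
      proof -
        have "sw (\<lambda>b1 b2. scale (u (b1 * S b2)) (S a)) b = scale (\<epsilon> b) (S a)" for a b
          using linear_of_sw[OF dual_linear[OF u_dual], of "\<lambda>b1 b2. b1 * S b2" b] dual_linear[OF u_dual]
          by (simp add: sw_scale_left[symmetric] sw_antipode_right Vector_Spaces.linear_iff u_one)
        then show ?thesis by simp
      qed
      also have "\<dots> = S y" by (rule sw_counit_right[OF antipode_linear])
      finally show ?thesis .
    qed
    have "sw (\<lambda>a b. a * S (proj b)) h = sw (\<lambda>a b. sw (\<lambda>c d. a * K (S d) c) (proj b)) h"
      by (simp only: mult_sw[symmetric] K_S)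
    also have "\<dots> \<simeq> sw (\<lambda>a b. sw (\<lambda>c d. c * K (S (proj b)) (proj d)) a) h"
      by (rule coassoc_right[OF h]) (rule r | intro H0_mult K_in, assumption+)+
    finally have "sw (\<lambda>a b. a * S (proj b)) h \<simeq> sw (\<lambda>a b. sw (\<lambda>c d. c * K (S (proj b)) (proj d)) a) h" .
    moreover have "sw (\<lambda>a b. sw (\<lambda>c d. c * K (S (proj b)) (proj d)) a) h \<in> H0"
    proof (rule sw_in_subspace[OF comult_filtration_1[OF h] _ subspace_coradical])
      fix a b assume "(a, b) \<in> H1 \<times> H0 \<union> H0 \<times> H1"
      then have "a \<in> H1" using coradical_subset_filtration_1 by blast
      then show "sw (\<lambda>c d. c * K (S (proj b)) (proj d)) a \<in> H0"
        by (rule E) (intro H0_antipode proj_in)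
    qed (rule r)+
    ultimately show ?thesis by (rule eqv_mem)
  qed
  \<comment> \<open>The Hopf module argument \<open>h = \<Sum>h_1 S(h_2) h_3\<close>, where
    \<open>\<Sum>h_1 S(h_2)\<close> falls into \<open>H0\<close> by \<open>T\<close>.\<close>
  have "h = sw (\<lambda>a b. scale (\<epsilon> b) a) h"
    using counit_right[of h] by (simp add: sw_def)
  also have "\<dots> \<simeq> sw (\<lambda>a b. scale (\<epsilon> (proj b)) a) h"
    by (rule sw_proj_right[OF h]) (rule r counit_linear | rule H0_scale, assumption)+
  also have "\<dots> = sw (\<lambda>a b. sw (\<lambda>c d. a * (S c * d)) (proj b)) h"
    by (simp add: mult_sw[symmetric] sw_antipode_left mult_scale_right)
  also have "\<dots> \<simeq> sw (\<lambda>a b. sw (\<lambda>c d. c * (S (proj d) * proj b)) a) h"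
    by (rule coassoc_right[OF h]) (rule r | intro H0_mult H0_antipode, assumption+)+
  finally have "h \<simeq> sw (\<lambda>a b. sw (\<lambda>c d. c * (S (proj d) * proj b)) a) h" .
  moreover have "sw (\<lambda>a b. sw (\<lambda>c d. c * (S (proj d) * proj b)) a) h \<in> H0"
  proof (rule sw_in_subspace[OF comult_filtration_1[OF h] _ subspace_coradical])
    fix a b assume "(a, b) \<in> H1 \<times> H0 \<union> H0 \<times> H1"
    then have "a \<in> H1" using coradical_subset_filtration_1 by blast
    from H0_mult[OF T[OF this] proj_in[of b]]
    show "sw (\<lambda>c d. c * (S (proj d) * proj b)) a \<in> H0"
      by (simp add: sw_mult mult.assoc)
  qed (rule r)+
  ultimately show ?thesis by (rule eqv_mem)
qed

text \<open>Modulo \<open>H\<^sub>0\<close>, this is the projection of the left Hopf module \<open>H\<^sub>1/H\<^sub>0\<close> onto its left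
  coinvariants.\<close>

definition left_coinv :: "'b \<Rightarrow> 'b" where
  "left_coinv m = sw (\<lambda>a b. S (proj a) * b) m"

lemma linear_left_coinv: "Vector_Spaces.linear scale scale left_coinv"
  unfolding left_coinv_def by (rule H_rules)+

lemma left_coinv_H0: "x \<in> H0 \<Longrightarrow> left_coinv x \<in> H0"
  unfolding left_coinv_def
proof (rule sw_in_subspace[OF comult_H0 _ subspace_coradical])
  show "S (proj a) * b \<in> H0" if "(a, b) \<in> H0 \<times> H0" for a b
    using that by (intro H0_mult H0_antipode proj_in) auto
qed (assumption | rule H_rules)+

text \<open>Antimultiplicativity of \<open>S\<close> brings \<open>S(x_1)\<close> next to
  \<open>x_2\<close> in \<open>S(x_1 m_1) x_2 m_2\<close>, where they contract to
  \<open>\<epsilon> x\<close>.\<close>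

lemma left_coinv_mult:
  assumes x: "x \<in> H0" and m: "m \<in> H1"
  shows "left_coinv (x * m) \<simeq> scale (\<epsilon> x) (left_coinv m)"
proof -
  define \<beta> where "\<beta> a b = sw (\<lambda>x1 x2. S (proj (x1 * a)) * (x2 * b)) x" for a b
  have "left_coinv (x * m) = sw (\<lambda>x1 x2. sw (\<lambda>a b. S (proj (x1 * a)) * (x2 * b)) m) x"
    unfolding left_coinv_def by (rule sw_of_mult[where s = scale]) (rule H_rules)+
  also have "\<dots> = sw \<beta> m" unfolding \<beta>_def by (rule sw_swap)
  \<comment> \<open>With the left factor moved into \<open>H0\<close>, the outer \<open>proj\<close>
    fixes the product \<open>x1 * proj a\<close>.\<close>
  also have "\<dots> \<simeq> sw (\<lambda>a b. \<beta> (proj a) b) m"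
  proof (rule sw_proj_left[OF m])
    fix a b assume b: "b \<in> H0"
    show "\<beta> a b \<in> H0" unfolding \<beta>_def
    proof (rule sw_in_subspace[OF comult_H0[OF x] _ subspace_coradical])
      show "S (proj (x1 * a)) * (x2 * b) \<in> H0" if "(x1, x2) \<in> H0 \<times> H0" for x1 x2
        using that b by (intro H0_mult H0_antipode proj_in) auto
    qed (rule H_rules)+
  qed (unfold \<beta>_def, (rule H_rules)+)
  also have "\<dots> = sw (\<lambda>a b. scale (\<epsilon> x) (S (proj a) * b)) m"
  proof -
    have "\<beta> (proj a) b = scale (\<epsilon> x) (S (proj a) * b)" for a b
    proof -
      have "\<beta> (proj a) b = sw (\<lambda>x1 x2. S (proj a) * ((S x1 * x2) * b)) x"
        unfolding \<beta>_def
      proof (rule sw_cong_tensors[OF comult_H0[OF x], where s = scale])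
        show "S (proj (x1 * proj a)) * (x2 * b) = S (proj a) * ((S x1 * x2) * b)"
          if "(x1, x2) \<in> H0 \<times> H0" for x1 x2
          using that proj_id[OF H0_mult[OF _ proj_in[of a]], of x1] by (simp add: antipode_mult mult.assoc)
      qed (rule H_rules)+
      then show ?thesis
        by (simp only: mult_sw[symmetric] sw_mult[symmetric] sw_antipode_left mult_scale_left mult_scale_right)
          simp
    qed
    then show ?thesis by simp
  qed
  also have "\<dots> = scale (\<epsilon> x) (left_coinv m)" by (simp add: left_coinv_def scale_sw)
  finally show ?thesis .
qed

section \<open>Hopf powers of right coinvariants modulo the coradical\<close>

lemma hopf_power_H0: "x \<in> H0 \<Longrightarrow> hopf_power x (Suc n) \<in> H0"
proof (induction n arbitrary: x)
  case 0
  then show ?case using hopf_power_1 by simp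
next
  case (Suc n)
  have "sw (\<lambda>a b. hopf_power a (Suc n) * b) x \<in> H0"
  proof (rule sw_in_subspace[OF comult_H0[OF Suc.prems] _ subspace_coradical])
    show "hopf_power a (Suc n) * b \<in> H0" if "(a, b) \<in> H0 \<times> H0" for a b
      using that Suc.IH by (intro H0_mult) auto
  qed (rule H_rules linear_hopf_power linear_comp[OF linear_hopf_power])+
  then show ?case by (simp add: hopf_power_Suc)
qed

lemma scale_nat_add: "scale (of_nat (Suc n)) x = scale (of_nat n) x + x"
  by (simp add: scale_left_distrib)

text \<open>The next power of \<open>u \<rightharpoonup> h\<close> is a sum of products
  \<open>hopf_power a (Suc n) * (u \<rightharpoonup> b)\<close> over \<open>\<Delta> h\<close>.
  Terms with \<open>b\<close> in \<open>H0\<close> reproduce the previous power, terms with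
  \<open>a\<close> in \<open>H0\<close> add one copy of
  \<open>left_coinv (u \<rightharpoonup> h)\<close>.\<close>

lemma left_coinv_hopf_power:
  assumes h: "h \<in> H1"
  shows "left_coinv (hopf_power (u \<rightharpoonup> h) (Suc n)) \<simeq> scale (of_nat (Suc n)) (left_coinv (u \<rightharpoonup> h))"
proof (induction n)
  case 0
  show ?case using hopf_power_1 subspace_0[OF subspace_coradical] by (simp add: eqv_def)
next
  case (Suc n)
  let ?r = "u \<rightharpoonup> h" and ?hp = "\<lambda>a. hopf_power a (Suc n)"
  note hp = linear_hopf_power[of n] and P = linear_left_coinv and U = linear_hit[OF u_dual]
  note r = H_rules hp linear_comp[OF hp] P linear_comp[OF P] U linear_comp[OF U]
  have "left_coinv (hopf_power ?r (Suc (Suc n))) = sw (\<lambda>a b. left_coinv (?hp a * b)) ?r"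
    by (simp add: hopf_power_Suc linear_of_sw[OF P])
  also have "\<dots> = sw (\<lambda>a b. left_coinv (?hp a * (u \<rightharpoonup> b))) h"
    by (rule sw_hit[OF u_dual]) (rule r)+
  \<comment> \<open>Each summand has the right value on one type of term and falls into
    \<open>H0\<close> on the other, so one bilinear expression serves both.\<close>
  also have "\<dots> \<simeq> sw (\<lambda>a b. scale (\<epsilon> (u \<rightharpoonup> b)) (left_coinv (?hp a)) + scale (\<epsilon> a) (left_coinv (u \<rightharpoonup> b))) h"
    unfolding eqv_def
  proof (rule sw_diff_in_subspace[OF comult_filtration_1[OF h] _ _ subspace_coradical])
    fix a b assume "(a, b) \<in> H1 \<times> H0 \<union> H0 \<times> H1"
    then consider "b \<in> H0" | "a \<in> H0" "b \<in> H1" by blast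
    then show "left_coinv (?hp a * (u \<rightharpoonup> b)) -
        (scale (\<epsilon> (u \<rightharpoonup> b)) (left_coinv (?hp a)) + scale (\<epsilon> a) (left_coinv (u \<rightharpoonup> b))) \<in> H0"
    proof cases
      case 1
      have "\<epsilon> (u \<rightharpoonup> b) = u b" using counit_linear
        by (simp add: hit_coradical[OF 1] Vector_Spaces.linear_iff counit_one)
      moreover have "left_coinv (?hp a * (u \<rightharpoonup> b)) = scale (u b) (left_coinv (?hp a))"
        using P by (simp add: hit_coradical[OF 1] mult_scale_right Vector_Spaces.linear_iff)
      moreover have "scale (\<epsilon> a) (left_coinv (u \<rightharpoonup> b)) \<in> H0"
        unfolding hit_coradical[OF 1] by (intro H0_scale left_coinv_H0 H0_one)
      ultimately show ?thesis using subspace_neg[OF subspace_coradical] by simp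
    next
      case 2
      have "left_coinv (?hp a * (u \<rightharpoonup> b)) - scale (\<epsilon> a) (left_coinv (u \<rightharpoonup> b)) \<in> H0"
        using left_coinv_mult[OF hopf_power_H0[OF 2(1)] filtration_1_hit(1)[OF u_dual 2(2)], of n]
        by (simp add: eqv_def counit_hopf_power)
      moreover have "scale (\<epsilon> (u \<rightharpoonup> b)) (left_coinv (?hp a)) \<in> H0"
        by (intro H0_scale left_coinv_H0 hopf_power_H0 2)
      ultimately have "left_coinv (?hp a * (u \<rightharpoonup> b)) - scale (\<epsilon> a) (left_coinv (u \<rightharpoonup> b)) -
          scale (\<epsilon> (u \<rightharpoonup> b)) (left_coinv (?hp a)) \<in> H0"
        by (rule subspace_diff[OF subspace_coradical])
      then show ?thesis by (simp add: diff_diff_eq add.commute)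
    qed
  next
    show "bilin scale (\<lambda>a b. left_coinv (?hp a * (u \<rightharpoonup> b)))" by (rule r)+
    have "bilin scale (\<lambda>a b. scale (\<epsilon> (u \<rightharpoonup> b)) (left_coinv (?hp a)))"
      "bilin scale (\<lambda>a b. scale (\<epsilon> a) (left_coinv (u \<rightharpoonup> b)))" by (rule r counit_linear)+
    then show "bilin scale (\<lambda>a b. scale (\<epsilon> (u \<rightharpoonup> b)) (left_coinv (?hp a)) + scale (\<epsilon> a) (left_coinv (u \<rightharpoonup> b)))"
      by (simp add: bilin_def Vector_Spaces.linear_iff algebra_simps)
  qed
  also have "\<dots> = sw (\<lambda>a b. scale (\<epsilon> (u \<rightharpoonup> b)) (left_coinv (?hp a))) h + sw (\<lambda>a b. scale (\<epsilon> a) (left_coinv (u \<rightharpoonup> b))) h"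
    by (simp add: sw_def split_def sum_list_addf)
  also have "sw (\<lambda>a b. scale (\<epsilon> (u \<rightharpoonup> b)) (left_coinv (?hp a))) h = sw (\<lambda>a b. scale (\<epsilon> b) (left_coinv (?hp a))) ?r"
    by (rule sw_hit[OF u_dual, symmetric]) (rule r counit_linear)+
  also have "\<dots> = left_coinv (?hp ?r)"
    by (rule sw_counit_right) (rule r)+
  also have "sw (\<lambda>a b. scale (\<epsilon> a) (left_coinv (u \<rightharpoonup> b))) h = left_coinv ?r"
    by (rule sw_counit_left) (rule r)+
  finally have "left_coinv (hopf_power ?r (Suc (Suc n))) \<simeq> left_coinv (?hp ?r) + left_coinv ?r" .
  also have "\<dots> \<simeq> scale (of_nat (Suc n)) (left_coinv ?r) + left_coinv ?r"
    using Suc by (simp add: eqv_def)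
  also have "\<dots> = scale (of_nat (Suc (Suc n))) (left_coinv ?r)" by (rule scale_nat_add[symmetric])
  finally show ?case .
qed

text \<open>\<open>r = \<Sum>r_1 S(r_2) r_3\<close> recovers \<open>r\<close> from left
  coinvariants; \<open>sw_hit\<close> then moves \<open>u\<close> onto the second factor, where
  \<open>triv\<close> applies.\<close>

lemma unit_component_in_H0_if_left_coinv_trivial:
  assumes triv: "\<And>h. h \<in> H1 \<Longrightarrow> left_coinv (u \<rightharpoonup> h) \<in> H0" and h: "h \<in> H1"
  shows "u \<rightharpoonup> h \<in> H0"
proof -
  let ?r = "u \<rightharpoonup> h"
  have r1: "?r \<in> H1" by (rule filtration_1_hit(1)[OF u_dual h])
  note P = linear_left_coinv and U = linear_hit[OF u_dual]
  note r = H_rules P linear_comp[OF P] U linear_comp[OF U] counit_linear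
  have "?r = sw (\<lambda>a b. scale (\<epsilon> a) b) ?r"
    using counit_left[of ?r] by (simp add: sw_def)
  also have "\<dots> \<simeq> sw (\<lambda>a b. scale (\<epsilon> (proj a)) b) ?r"
    by (rule sw_proj_left[OF r1]) (rule r | rule H0_scale, assumption)+
  also have "\<dots> = sw (\<lambda>a b. sw (\<lambda>c d. (c * S d) * b) (proj a)) ?r"
    by (simp add: sw_mult[symmetric] sw_antipode_right mult_scale_left)
  also have "\<dots> \<simeq> sw (\<lambda>a b. sw (\<lambda>c d. (proj a * S (proj c)) * d) b) ?r"
    by (rule coassoc_left[OF r1]) (rule r | intro H0_mult H0_antipode, assumption+)+
  also have "\<dots> = sw (\<lambda>a b. proj a * left_coinv b) ?r"
    by (simp add: left_coinv_def mult_sw mult.assoc)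
  also have "\<dots> = sw (\<lambda>a b. proj a * left_coinv (u \<rightharpoonup> b)) h"
    by (rule sw_hit[OF u_dual]) (rule r)+
  finally have "?r \<simeq> sw (\<lambda>a b. proj a * left_coinv (u \<rightharpoonup> b)) h" .
  moreover have "sw (\<lambda>a b. proj a * left_coinv (u \<rightharpoonup> b)) h \<in> H0"
  proof (rule sw_in_subspace[OF comult_filtration_1[OF h] _ subspace_coradical])
    fix a b assume "(a, b) \<in> H1 \<times> H0 \<union> H0 \<times> H1"
    then have "b \<in> H1" using coradical_subset_filtration_1 by blast
    then show "proj a * left_coinv (u \<rightharpoonup> b) \<in> H0" by (intro H0_mult proj_in triv)
  qed (rule r)+
  ultimately show ?thesis by (rule eqv_mem)
qed

end

section \<open>The idempotent at the unit, and the conclusion\<close>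

context hopf_algebra
begin

text \<open>\<open>1\<close> is grouplike, so both dual actions send it to a multiple of itself, and
  a line has no proper nonzero subspace.\<close>

lemma span_one_simple: "span {1} \<in> simple_subcoalgebras"
  unfolding simple_subcoalgebras_def mem_Collect_eq
proof (intro conjI allI impI)
  have one: "(1::'b) \<noteq> 0" using counit_one dual_zero[OF counit_dual] by auto
  show "subcoalgebra (span {1})"
  proof (rule subcoalgebraI)
    fix f d assume f: "f \<in> dual" and "d \<in> span {1}"
    then obtain c where d: "d = scale c 1" by (auto simp: span_singleton)
    have "f \<rightharpoonup> 1 = scale (f 1) 1" "1 \<leftharpoonup> f = scale (f 1) 1"
      unfolding hit_sw hit_right_def
      using sw_eq[OF bilin_hit[OF f] comult_one] sw_eq[OF bilin_hit_right[OF f] comult_one] by simp_all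
    then show "f \<rightharpoonup> d \<in> span {1}" "d \<leftharpoonup> f \<in> span {1}"
      using linear_hit[OF f] linear_hit_right[OF f]
      by (auto simp: d Vector_Spaces.linear_iff span_singleton)
  qed simp
  show "span {1} \<noteq> {0::'b}" using one span_base[of 1 "{1}"] by auto
  fix D assume D: "subcoalgebra D \<and> D \<subseteq> span {1}"
  then have sub: "subspace D" by (simp add: subcoalgebra_def)
  show "D = {0} \<or> D = span {1}"
  proof (cases "D \<subseteq> {0}")
    case True
    then show ?thesis using subspace_0[OF sub] by auto
  next
    case False
    then obtain d where d: "d \<in> D" "d \<noteq> 0" by blast
    then obtain c where c: "d = scale c 1" using D by (auto simp: span_singleton)
    then have "c \<noteq> 0" using d by auto
    then have "1 = scale (inverse c) d" by (simp add: c)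
    then have "1 \<in> D" using subspace_scale[OF sub d(1)] by metis
    then have "span {1} \<subseteq> D" using span_minimal sub by simp
    then show ?thesis using D by blast
  qed
qed

text \<open>The last claim is linear in \<open>x\<close>, so \<open>x\<close> may be taken in a
  simple subcoalgebra \<open>C\<close>. On the line of \<open>1\<close>, grouplikeness decides;
  otherwise the functional vanishes on \<open>C\<close>, hence on the right factors of
  \<open>\<Delta> x\<close>.\<close>

lemma unit_idempotent:
  assumes "coradical_orthonormal_idempotents e"
  shows "e (span {1}) \<in> dual" "e (span {1}) 1 = 1"
    and "x \<in> coradical \<Longrightarrow> e (span {1}) \<rightharpoonup> x = scale (e (span {1}) x) 1"
proof -
  let ?u = "e (span {1})"
  note e = assms[unfolded coradical_orthonormal_idempotents_def]
  show u: "?u \<in> dual" using e span_one_simple by blast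
  have restr: "?u x = (if span {1} = C then \<epsilon> x else 0)" if "C \<in> simple_subcoalgebras" "x \<in> C" for C x
    using e span_one_simple that by blast
  show "?u 1 = 1" using restr[OF span_one_simple, of 1] by (simp add: span_base counit_one)
  interpret p: vector_space_pair scale scale by unfold_locales
  assume x: "x \<in> coradical"
  show "?u \<rightharpoonup> x = scale (?u x) 1"
  proof (rule p.linear_eq_on[OF linear_hit[OF u] linear_scale_left[OF dual_linear[OF u]] x[unfolded coradical_def]])
    fix x assume "x \<in> \<Union>simple_subcoalgebras"
    then obtain C where C: "C \<in> simple_subcoalgebras" "x \<in> C" by blast
    show "?u \<rightharpoonup> x = scale (?u x) 1"
    proof (cases "span {1} = C")
      case True
      then obtain c where c: "x = scale c 1" using C by (auto simp: span_singleton)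
      have "?u \<rightharpoonup> 1 = scale (?u 1) 1"
        unfolding hit_sw using sw_eq[OF bilin_hit[OF u] comult_one] by simp
      then show ?thesis using linear_hit[OF u] dual_linear[OF u] by (simp add: c Vector_Spaces.linear_iff)
    next
      case False
      have "\<Delta> x \<in> tensors (C \<times> C)" using C by (auto simp: simple_subcoalgebras_def subcoalgebra_def)
      then have "sw (\<lambda>a b. scale (?u b) a) x \<in> {0}"
        by (rule sw_in_subspace[OF _ bilin_hit[OF u]]) (use restr[OF C(1)] False in auto)
      then show ?thesis using restr[OF C] False by (simp add: hit_sw)
    qed
  qed
qed

end

theorem theorem4p1:
  fixes scale :: "'k::field_char_0 \<Rightarrow> 'h::ring_1 \<Rightarrow> 'h"
    and \<Delta> :: "'h \<Rightarrow> ('h list \<Rightarrow>\<^sub>0 'k) set"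
    and \<epsilon> :: "'h \<Rightarrow> 'k"
    and S :: "'h \<Rightarrow> 'h"
    and e :: "'h set \<Rightarrow> 'h \<Rightarrow> 'k"
  assumes "hopf_algebra scale \<Delta> \<epsilon> S"
    and "\<not> coalgebra.cosemisimple scale \<Delta>"
    and "coalgebra.coradical_orthonormal_idempotents scale \<Delta> \<epsilon> e"
    and "hopf_algebra.hopf_subalgebra scale \<Delta> S (coalgebra.coradical scale \<Delta>)"
    and "tensor_powers.finite_dimensional scale (coalgebra.coradical scale \<Delta>)"
  shows "(\<exists>h \<in> hopf_algebra.unit_component scale \<Delta> e (coalgebra.coradical_filtration scale \<Delta> 1).
            hopf_algebra.hopf_order scale \<Delta> \<epsilon> h = \<infinity>) \<and>
         hopf_algebra.exponent scale \<Delta> \<epsilon> = \<infinity>"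
proof -
  interpret hopf_algebra scale \<Delta> \<epsilon> S by (rule assms)
  obtain \<pi> where \<pi>: "Vector_Spaces.linear scale scale \<pi>" "\<And>x. \<pi> x \<in> coradical"
    "\<And>x. x \<in> coradical \<Longrightarrow> \<pi> x = x"
    using linear_projection[OF subspace_coradical] by blast
  interpret hopf_coradical scale \<Delta> \<epsilon> S "e (span {1})" \<pi>
    by (intro hopf_coradical.intro hopf_coradical_axioms.intro)
      (rule hopf_algebra_axioms assms(4) \<pi> unit_idempotent[OF assms(3)] | assumption)+
  have "\<exists>h\<in>H1. left_coinv (e (span {1}) \<rightharpoonup> h) \<notin> H0"
  proof (rule ccontr)
    assume "\<not> ?thesis"
    then have "H1 \<subseteq> H0"
      using H1_subset_if_unit_component_trivial unit_component_in_H0_if_left_coinv_trivial by blast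
    with filtration_1_not_subset_coradical[OF assms(5,2)] show False ..
  qed
  then obtain h where h: "h \<in> H1" and ne: "left_coinv (e (span {1}) \<rightharpoonup> h) \<notin> H0" by blast
  let ?r = "e (span {1}) \<rightharpoonup> h"
  have nontrivial: "\<not> trivial_hopf_power ?r n" if "n \<ge> 1" for n
  proof
    assume triv: "trivial_hopf_power ?r n"
    obtain m where m: "n = Suc m" using \<open>n \<ge> 1\<close> by (cases n) auto
    have "left_coinv (hopf_power ?r n) \<in> H0"
      using triv unfolding trivial_hopf_power_def by (simp add: left_coinv_H0 H0_scale H0_one)
    with eqv_mem[OF eqv_sym[OF left_coinv_hopf_power[OF h, of m]]]
    have "scale (of_nat n) (left_coinv ?r) \<in> H0" by (simp add: m)
    \<comment> \<open>Characteristic 0 makes \<open>of_nat n\<close> invertible.\<close>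
    from H0_scale[OF this, of "inverse (of_nat n)"] have "left_coinv ?r \<in> H0"
      using \<open>n \<ge> 1\<close> by simp
    with ne show False ..
  qed
  \<comment> \<open>A finite exponent would in particular give \<open>?r\<close> a trivial Hopf
    power.\<close>
  then have "hopf_order ?r = \<infinity>" "exponent = \<infinity>"
    by (auto simp: hopf_order_def exponent_def)
  moreover have "?r \<in> unit_component e H1" using h by (auto simp: unit_component_def)
  ultimately show ?thesis by blast
qed

end
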